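(* Let $\gamma:S^n\to\mathbb R_{>0}$ be of class $C^2$, with Wulff shape $W_\gamma$ and Cahn-Hoffman map $\xi_\gamma:S^n\to\mathbb R^{n+1}$, and set $\hat W_\gamma:=\xi_\gamma(S^n)$. (i) $W_\gamma\subset\hat W_\gamma$. (ii) The following (a), (b), (c) are equivalent: (a) $\gamma$ is a convex integrand; (b) $W_\gamma=\hat W_\gamma$; (c) $D^2\gamma+\gamma\cdot1$ is positive-semidefinite, that is, its eigenvalues are all nonnegative on the tangent space at each point of $S^n$. (iii) If $\gamma$ is uniformly convex, that is, the eigenvalues of $D^2\gamma+\gamma\cdot1$ are all positive on the tangent space at each point of $S^n$, then $\xi_\gamma:S^n\to\mathbb R^{n+1}$ is an embedding onto $W_\gamma$. In this case, for each $\nu\in S^n$, $\nu$ coincides with the outward-pointing unit normal of $W_\gamma$ at the point $\xi_\gamma(\nu)$, and $\gamma$ is the support function of $W_\gamma$, that is, $\gamma(\nu)=\langle\xi_\gamma(\nu),\nu\rangle$ holds.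
   Context: $S^n$ is the unit sphere in $\mathbb R^{n+1}$; $D\gamma$ and $D^2\gamma$ denote the gradient and Hessian of $\gamma$ on $S^n$, and $1$ is the identity. The Wulff shape $W_\gamma$ is the boundary of the convex set $\cap_{\nu\in S^n}\{Y\in\mathbb R^{n+1}\mid\langle Y,\nu\rangle\le\gamma(\nu)\}$. The Cahn-Hoffman map is $\xi_\gamma(\nu)=D\gamma|_\nu+\gamma(\nu)\nu$, with $T_\nu S^n$ regarded as a linear subspace of $\mathbb R^{n+1}$. $\gamma$ is a convex integrand if the set $\{\gamma(\nu)^{-1}\nu\mid\nu\in S^n\}$ (the Wulff plot of $1/\gamma$) is a convex closed hypersurface, i.e. every straight segment joining two of its points lies in the closure of the bounded domain it encloses; equivalently, the homogeneous extension $\overline\gamma(rY)=r\gamma(Y)$ ($Y\in S^n$, $r\ge0$) is a convex function on $\mathbb R^{n+1}$. The support function of a convex closed hypersurface $S$ is $\sigma_S(\nu)=\min\{a\in\mathbb R\mid S\subset\{Y\mid\langle Y,\nu\rangle\le a\}\}$, $\nu\in S^n$. *)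

theory Defs
  imports "HOL-Analysis.Analysis"
begin

text \<open>
  The sphere \<open>S\<^sup>n\<close> is \<open>sphere 0 1\<close> in an arbitrary Euclidean space \<open>'a\<close> with
  \<open>DIM('a) = n + 1\<close>.  Functions on it are functions on \<open>'a\<close> of which only the
  values on \<open>sphere 0 1\<close> matter.
\<close>

section \<open>Calculus on the unit sphere\<close>

definition C1_on :: "'a::euclidean_space set \<Rightarrow> ('a \<Rightarrow> 'b::real_normed_vector) \<Rightarrow> bool" where
  "C1_on U F \<longleftrightarrow> (\<exists>F' :: 'a \<Rightarrow> 'a \<Rightarrow>\<^sub>L 'b.
     (\<forall>x\<in>U. (F has_derivative blinfun_apply (F' x)) (at x)) \<and> continuous_on U F')"

definition C2_on :: "'a::euclidean_space set \<Rightarrow> ('a \<Rightarrow> 'b::real_normed_vector) \<Rightarrow> bool" where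
  "C2_on U F \<longleftrightarrow> (\<exists>F' :: 'a \<Rightarrow> 'a \<Rightarrow>\<^sub>L 'b.
     (\<forall>x\<in>U. (F has_derivative blinfun_apply (F' x)) (at x)) \<and> C1_on U F')"

text \<open>
  Class \<open>C\<^sup>k\<close> on the submanifold \<open>S\<^sup>n\<close>: near each of its points, the map is the
  restriction of a \<open>C\<^sup>k\<close> map on an open subset of the ambient space.
\<close>

definition C1_on_sphere :: "('a::euclidean_space \<Rightarrow> 'b::real_normed_vector) \<Rightarrow> bool" where
  "C1_on_sphere f \<longleftrightarrow> (\<forall>p\<in>sphere 0 1. \<exists>U F. open U \<and> p \<in> U \<and> C1_on U F \<and>
     (\<forall>x\<in>U \<inter> sphere 0 1. F x = f x))"

definition C2_on_sphere :: "('a::euclidean_space \<Rightarrow> 'b::real_normed_vector) \<Rightarrow> bool" where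
  "C2_on_sphere f \<longleftrightarrow> (\<forall>p\<in>sphere 0 1. \<exists>U F. open U \<and> p \<in> U \<and> C2_on U F \<and>
     (\<forall>x\<in>U \<inter> sphere 0 1. F x = f x))"

definition sphere_tangent :: "'a::euclidean_space \<Rightarrow> 'a set" where
  "sphere_tangent \<nu> = {v. v \<bullet> \<nu> = 0}"

text \<open>
  The differential of \<open>f\<close> at \<open>\<nu>\<close> along the sphere.  The derivative within
  \<open>sphere 0 1\<close> determines a linear map only on the tangent space at \<open>\<nu>\<close>; requiring
  it to vanish on the normal line makes it unique.
\<close>

definition sphere_deriv ::
  "('a::euclidean_space \<Rightarrow> 'b::real_normed_vector) \<Rightarrow> 'a \<Rightarrow> 'a \<Rightarrow> 'b" where
  "sphere_deriv f \<nu> = (THE L. (f has_derivative L) (at \<nu> within sphere 0 1) \<and> L \<nu> = 0)"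

definition sphere_grad :: "('a::euclidean_space \<Rightarrow> real) \<Rightarrow> 'a \<Rightarrow> 'a" where
  "sphere_grad \<gamma> \<nu> =
     (THE g. g \<in> sphere_tangent \<nu> \<and> (\<forall>v\<in>sphere_tangent \<nu>. g \<bullet> v = sphere_deriv \<gamma> \<nu> v))"

text \<open>
  The Hessian as an endomorphism of the tangent space: the Levi-Civita covariant
  derivative of the gradient field, i.e. the tangential component of its derivative in
  the ambient space.
\<close>

definition sphere_hess :: "('a::euclidean_space \<Rightarrow> real) \<Rightarrow> 'a \<Rightarrow> 'a \<Rightarrow> 'a" where
  "sphere_hess \<gamma> \<nu> v =
     (let w = sphere_deriv (sphere_grad \<gamma>) \<nu> v in w - (w \<bullet> \<nu>) *\<^sub>R \<nu>)"

definition eigenvalue_on :: "'a::real_vector set \<Rightarrow> ('a \<Rightarrow> 'a) \<Rightarrow> real \<Rightarrow> bool" where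
  "eigenvalue_on V A c \<longleftrightarrow> (\<exists>v\<in>V. v \<noteq> 0 \<and> A v = c *\<^sub>R v)"

text \<open>A \<open>C\<^sup>1\<close> embedding: an immersion that is a homeomorphism onto its image.\<close>

definition sphere_embedding :: "('a::euclidean_space \<Rightarrow> 'b::euclidean_space) \<Rightarrow> bool" where
  "sphere_embedding f \<longleftrightarrow> C1_on_sphere f \<and>
     (\<forall>\<nu>\<in>sphere 0 1. inj_on (sphere_deriv f \<nu>) (sphere_tangent \<nu>)) \<and>
     (\<exists>g. homeomorphism (sphere 0 1) (f ` sphere 0 1) f g)"

section \<open>Hypersurfaces\<close>

text \<open>
  The segment condition for a closed hypersurface \<open>S\<close>; the bounded domain enclosed by
  \<open>S\<close> is \<open>inside S\<close>, the union of the bounded components of the complement.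
\<close>

definition convex_hypersurface :: "'a::euclidean_space set \<Rightarrow> bool" where
  "convex_hypersurface S \<longleftrightarrow>
     (\<forall>x\<in>S. \<forall>y\<in>S. closed_segment x y \<subseteq> closure (inside S))"

definition support_function :: "'a::euclidean_space set \<Rightarrow> 'a \<Rightarrow> real" where
  "support_function S \<nu> = (LEAST a. S \<subseteq> {Y. Y \<bullet> \<nu> \<le> a})"

definition tangent_vectors :: "'a::euclidean_space set \<Rightarrow> 'a \<Rightarrow> 'a set" where
  "tangent_vectors S p = {v. \<exists>c e. e > 0 \<and> c 0 = p \<and> (\<forall>t. \<bar>t\<bar> < e \<longrightarrow> c t \<in> S) \<and>
     (c has_vector_derivative v) (at (0::real))}"

definition outward_unit_normal :: "'a::euclidean_space set \<Rightarrow> 'a \<Rightarrow> 'a \<Rightarrow> bool" where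
  "outward_unit_normal S p N \<longleftrightarrow> norm N = 1 \<and> (\<forall>v\<in>tangent_vectors S p. v \<bullet> N = 0) \<and>
     (\<exists>e>0. \<forall>t. 0 < t \<and> t < e \<longrightarrow> p + t *\<^sub>R N \<in> outside S \<and> p - t *\<^sub>R N \<in> inside S)"

section \<open>Wulff shape and Cahn-Hoffman map\<close>

definition wulff_shape :: "('a::euclidean_space \<Rightarrow> real) \<Rightarrow> 'a set" where
  "wulff_shape \<gamma> = frontier (\<Inter>\<nu>\<in>sphere 0 1. {Y. Y \<bullet> \<nu> \<le> \<gamma> \<nu>})"

definition cahn_hoffman :: "('a::euclidean_space \<Rightarrow> real) \<Rightarrow> 'a \<Rightarrow> 'a" where
  "cahn_hoffman \<gamma> \<nu> = sphere_grad \<gamma> \<nu> + \<gamma> \<nu> *\<^sub>R \<nu>"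

text \<open>
  For continuous positive \<open>\<gamma>\<close> the Wulff plot of \<open>1 / \<gamma>\<close> is a radial graph over the
  sphere, hence automatically a closed hypersurface; only its convexity is a condition.
\<close>

definition convex_integrand :: "('a::euclidean_space \<Rightarrow> real) \<Rightarrow> bool" where
  "convex_integrand \<gamma> \<longleftrightarrow> convex_hypersurface ((\<lambda>\<nu>. inverse (\<gamma> \<nu>) *\<^sub>R \<nu>) ` sphere 0 1)"

text \<open>The endomorphism \<open>D\<^sup>2\<gamma> + \<gamma> \<cdot> 1\<close> of the tangent space at \<open>\<nu>\<close>.\<close>

definition wulff_operator :: "('a::euclidean_space \<Rightarrow> real) \<Rightarrow> 'a \<Rightarrow> 'a \<Rightarrow> 'a" where
  "wulff_operator \<gamma> \<nu> v = sphere_hess \<gamma> \<nu> v + \<gamma> \<nu> *\<^sub>R v"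

definition pos_semidefinite_integrand :: "('a::euclidean_space \<Rightarrow> real) \<Rightarrow> bool" where
  "pos_semidefinite_integrand \<gamma> \<longleftrightarrow> (\<forall>\<nu>\<in>sphere 0 1. \<forall>c.
     eigenvalue_on (sphere_tangent \<nu>) (wulff_operator \<gamma> \<nu>) c \<longrightarrow> c \<ge> 0)"

definition uniformly_convex_integrand :: "('a::euclidean_space \<Rightarrow> real) \<Rightarrow> bool" where
  "uniformly_convex_integrand \<gamma> \<longleftrightarrow> (\<forall>\<nu>\<in>sphere 0 1. \<forall>c.
     eigenvalue_on (sphere_tangent \<nu>) (wulff_operator \<gamma> \<nu>) c \<longrightarrow> c > 0)"

end

theory Submission imports Defs begin

text \<open>
  Extend \<open>\<gamma>\<close> to the positively homogeneous function \<open>F x = \<bar>x\<bar> \<gamma>(x / \<bar>x\<bar>)\<close> on the whole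
  space.  Away from the origin \<open>F\<close> has a gradient \<open>X\<close> of class \<open>C\<^sup>1\<close>, and everything in the
  theorem is a statement about \<open>X\<close> and its derivative \<open>H\<close>.  On the sphere \<open>X\<close> is the
  Cahn-Hoffman map: the tangential part of \<open>X \<nu>\<close> is the gradient of \<open>\<gamma>\<close>, and its normal part
  is \<open>X \<nu> \<bullet> \<nu> = F \<nu> = \<gamma> \<nu>\<close> by Euler's relation (\<open>cahn_hoffman_eq\<close>).  Homogeneity and the
  symmetry of second derivatives make \<open>H \<nu>\<close> annihilate \<open>\<nu>\<close> and map into the tangent space,
  where it coincides with \<open>D\<^sup>2\<gamma> + \<gamma> \<cdot> 1\<close> (\<open>wulff_operator_eq\<close>).

  The convex body \<open>K\<close> bounded by the Wulff shape consists of the \<open>Y\<close> with \<open>Y \<bullet> x \<le> F x\<close> for all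
  \<open>x\<close>; by compactness of the sphere \<open>Y \<in> K\<close> is a boundary point exactly if equality holds for
  some unit vector \<open>\<nu>\<close>.  Then \<open>F x - Y \<bullet> x\<close> is minimal at \<open>\<nu>\<close>, so its gradient vanishes there
  and \<open>Y = X \<nu>\<close> (\<open>contact_point\<close>).  This is the inclusion of the Wulff shape in the image of
  the Cahn-Hoffman map.

  The three equivalent conditions are each compared with the single condition
  \<open>tangent_planes_support\<close>, namely \<open>X y \<bullet> x \<le> F x\<close> for all \<open>x\<close> and all \<open>y \<noteq> 0\<close>: the graph of
  \<open>F\<close> lies above its tangent planes.  For the image of the Cahn-Hoffman map this says
  \<open>X \<nu> \<in> K\<close>.  For a convex integrand it is the inequality between a convex function and its
  linearisation; conversely, a pointwise supremum of linear functions is convex.  If the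
  tangent planes support, then \<open>X\<close> is a monotone map, hence its derivative is positive
  semidefinite; conversely, if \<open>H\<close> is positive semidefinite, then \<open>F\<close> is convex along every
  segment that avoids the origin, while a segment through the origin joins opposite rays, where
  the inequality follows from \<open>F \<ge> 0\<close>.  Eigenvalues control the quadratic form because the
  minimum of the Rayleigh quotient of a symmetric operator is an eigenvalue
  (\<open>symmetric_least_eigenvalue\<close>).

  If \<open>\<gamma>\<close> is uniformly convex, the quadratic form of \<open>H\<close> is positive on all non-radial vectors,
  so \<open>X\<close> is strictly monotone along non-radial segments and thus injective on the sphere
  (\<open>uniformly_convex_inj\<close>).  Compactness makes it a homeomorphism onto its image, and \<open>H \<nu>\<close> is
  injective on the tangent space.  Injectivity also says that \<open>\<nu>\<close> is the only direction in which
  the supporting plane of \<open>K\<close> passes through \<open>X \<nu>\<close>; hence moving from \<open>X \<nu>\<close> along \<open>- \<nu>\<close> enters the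
  interior of \<open>K\<close>, and \<open>\<nu>\<close> is an outward normal.  It is the only one, because all
  \<open>H \<nu> v\<close> are tangent to the Wulff shape: the tangential part \<open>n\<close> of a normal satisfies
  \<open>H \<nu> n \<bullet> n = 0\<close>, so \<open>n = 0\<close>.
\<close>

section \<open>Maps of class \<open>C\<^sup>1\<close>\<close>

text \<open>
  In finite dimension, continuity of the derivative in the operator norm can be tested on each
  vector separately.  With this rule and the next one, derivatives can be treated as ordinary
  two-place functions.
\<close>

lemma C1_onI:
  fixes f :: "'a::euclidean_space \<Rightarrow> 'b::real_normed_vector"
  assumes der: "\<And>x. x \<in> U \<Longrightarrow> (f has_derivative D x) (at x)"
    and cont: "\<And>v. continuous_on U (\<lambda>x. D x v)"
  shows "C1_on U f"
proof -
  have D: "blinfun_apply (Blinfun (D x)) = D x" if "x \<in> U" for x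
    using der[OF that] by (simp add: bounded_linear_Blinfun_apply has_derivative_bounded_linear)
  have "continuous_on U (\<lambda>x. Blinfun (D x))"
  proof (rule continuous_on_blinfun_componentwise)
    fix i :: 'a
    show "continuous_on U (\<lambda>x. blinfun_apply (Blinfun (D x)) i)"
      using cont[of i] by (simp add: D cong: continuous_on_cong)
  qed
  with der D show ?thesis
    unfolding C1_on_def by (intro exI[of _ "\<lambda>x. Blinfun (D x)"]) auto
qed

lemma C1_onE:
  fixes f :: "'a::euclidean_space \<Rightarrow> 'b::real_normed_vector"
  assumes "C1_on U f"
  obtains D where "\<And>x. x \<in> U \<Longrightarrow> (f has_derivative D x) (at x)"
    and "\<And>v. continuous_on U (\<lambda>x. D x v)"
proof -
  obtain F' :: "'a \<Rightarrow> 'a \<Rightarrow>\<^sub>L 'b"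
    where "\<And>x. x \<in> U \<Longrightarrow> (f has_derivative F' x) (at x)" and "continuous_on U F'"
    using assms unfolding C1_on_def by blast
  then show thesis
    by (intro that[of "\<lambda>x. F' x"]) (auto intro!: continuous_intros)
qed

lemma C1_on_imp_continuous_on: "C1_on U f \<Longrightarrow> continuous_on U f"
  unfolding C1_on_def
  by (metis continuous_at_imp_continuous_on has_derivative_continuous)

lemma C1_on_subset: "C1_on U f \<Longrightarrow> V \<subseteq> U \<Longrightarrow> C1_on V f"
  unfolding C1_on_def by (meson continuous_on_subset subsetD)

lemma C1_on_transform:
  assumes "C1_on U f" "open U" "\<And>x. x \<in> U \<Longrightarrow> g x = f x"
  shows "C1_on U g"
  using assms unfolding C1_on_def
  by (metis (no_types, lifting) has_derivative_transform_within_open)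

lemma C1_on_locally:
  fixes f :: "'a::euclidean_space \<Rightarrow> 'b::real_normed_vector"
  assumes "\<And>p. p \<in> S \<Longrightarrow> \<exists>U. open U \<and> p \<in> U \<and> C1_on U f"
  shows "C1_on S f"
proof (rule C1_onI)
  show "(f has_derivative frechet_derivative f (at p)) (at p)" if "p \<in> S" for p
    using assms[OF that] unfolding C1_on_def
    by (metis differentiableI frechet_derivative_works)
  show "continuous_on S (\<lambda>x. frechet_derivative f (at x) v)" for v
  proof (rule continuous_at_imp_continuous_on, rule ballI)
    fix p assume "p \<in> S"
    then obtain U where U: "open U" "p \<in> U" "C1_on U f"
      using assms by blast
    obtain D where D: "\<And>x. x \<in> U \<Longrightarrow> (f has_derivative D x) (at x)"
      and cont: "\<And>v. continuous_on U (\<lambda>x. D x v)"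
      by (rule C1_onE[OF U(3)]) blast
    have "continuous_on U (\<lambda>x. frechet_derivative f (at x) v)"
      using cont[of v] by (rule continuous_on_eq) (simp add: frechet_derivative_at[OF D])
    then show "isCont (\<lambda>x. frechet_derivative f (at x) v) p"
      using U continuous_on_eq_continuous_at by blast
  qed
qed

lemma C1_on_compose:
  fixes f :: "'a::euclidean_space \<Rightarrow> 'b::euclidean_space"
    and g :: "'b \<Rightarrow> 'c::real_normed_vector"
  assumes f: "C1_on U f" and g: "C1_on V g" and sub: "f ` U \<subseteq> V"
  shows "C1_on U (\<lambda>x. g (f x))"
proof -
  obtain F' :: "'a \<Rightarrow> 'a \<Rightarrow>\<^sub>L 'b" where F': "\<And>x. x \<in> U \<Longrightarrow> (f has_derivative F' x) (at x)"
    and cF': "continuous_on U F'"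
    using f unfolding C1_on_def by blast
  obtain G' :: "'b \<Rightarrow> 'b \<Rightarrow>\<^sub>L 'c" where G': "\<And>x. x \<in> V \<Longrightarrow> (g has_derivative G' x) (at x)"
    and cG': "continuous_on V G'"
    using g unfolding C1_on_def by blast
  show ?thesis
  proof (rule C1_onI)
    show "((\<lambda>x. g (f x)) has_derivative (\<lambda>v. G' (f x) (F' x v))) (at x)" if "x \<in> U" for x
      using has_derivative_compose[OF F'[OF that] G'] that sub by blast
    have "continuous_on U (\<lambda>x. G' (f x))"
      using cG' C1_on_imp_continuous_on[OF f] sub by (rule continuous_on_compose2)
    then show "continuous_on U (\<lambda>x. G' (f x) (F' x v))" for v
      using cF' by (intro continuous_intros)
  qed
qed

lemma C1_on_bilinear:
  fixes f :: "'a::euclidean_space \<Rightarrow> 'b::real_normed_vector"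
    and g :: "'a \<Rightarrow> 'c::real_normed_vector" and h :: "'b \<Rightarrow> 'c \<Rightarrow> 'd::real_normed_vector"
  assumes h: "bounded_bilinear h" and f: "C1_on U f" and g: "C1_on U g"
  shows "C1_on U (\<lambda>x. h (f x) (g x))"
proof -
  obtain F' where F': "\<And>x. x \<in> U \<Longrightarrow> (f has_derivative F' x) (at x)"
    and cF': "\<And>v. continuous_on U (\<lambda>x. F' x v)"
    by (rule C1_onE[OF f]) blast
  obtain G' where G': "\<And>x. x \<in> U \<Longrightarrow> (g has_derivative G' x) (at x)"
    and cG': "\<And>v. continuous_on U (\<lambda>x. G' x v)"
    by (rule C1_onE[OF g]) blast
  show ?thesis
  proof (rule C1_onI)
    show "((\<lambda>x. h (f x) (g x)) has_derivative (\<lambda>v. h (f x) (G' x v) + h (F' x v) (g x))) (at x)"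
      if "x \<in> U" for x
      using bounded_bilinear.FDERIV[OF h F'[OF that] G'[OF that]] .
    show "continuous_on U (\<lambda>x. h (f x) (G' x v) + h (F' x v) (g x))" for v
      by (intro continuous_on_add bounded_bilinear.continuous_on[OF h]
          C1_on_imp_continuous_on[OF f] C1_on_imp_continuous_on[OF g] cF' cG')
  qed
qed

lemma C1_on_add:
  fixes f g :: "'a::euclidean_space \<Rightarrow> 'b::real_normed_vector"
  assumes f: "C1_on U f" and g: "C1_on U g"
  shows "C1_on U (\<lambda>x. f x + g x)"
proof -
  obtain F' where F': "\<And>x. x \<in> U \<Longrightarrow> (f has_derivative F' x) (at x)"
    and cF': "\<And>v. continuous_on U (\<lambda>x. F' x v)"
    by (rule C1_onE[OF f]) blast
  obtain G' where G': "\<And>x. x \<in> U \<Longrightarrow> (g has_derivative G' x) (at x)"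
    and cG': "\<And>v. continuous_on U (\<lambda>x. G' x v)"
    by (rule C1_onE[OF g]) blast
  show ?thesis
    by (rule C1_onI[where D = "\<lambda>x v. F' x v + G' x v"])
       (auto intro!: continuous_on_add cF' cG' has_derivative_add F' G')
qed

lemma C1_on_bounded_linear:
  fixes f :: "'a::euclidean_space \<Rightarrow> 'b::real_normed_vector"
    and h :: "'b \<Rightarrow> 'c::real_normed_vector"
  assumes h: "bounded_linear h" and f: "C1_on U f"
  shows "C1_on U (\<lambda>x. h (f x))"
proof -
  obtain F' where F': "\<And>x. x \<in> U \<Longrightarrow> (f has_derivative F' x) (at x)"
    and cF': "\<And>v. continuous_on U (\<lambda>x. F' x v)"
    by (rule C1_onE[OF f]) blast
  show ?thesis
    by (rule C1_onI[where D = "\<lambda>x v. h (F' x v)"])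
       (auto intro!: bounded_linear.continuous_on[OF h] cF' bounded_linear.has_derivative[OF h] F')
qed

lemma C1_on_id: "C1_on U (\<lambda>x::'a::euclidean_space. x)"
  by (rule C1_onI[where D = "\<lambda>x v. v"]) auto

lemma has_derivative_norm_at:
  fixes x :: "'a::euclidean_space"
  assumes "x \<noteq> 0"
  shows "(norm has_derivative (\<lambda>v. (x \<bullet> v) / norm x)) (at x)"
  using has_derivative_norm[OF assms]
  by (simp add: sgn_div_norm divide_inverse mult.commute inner_commute)

lemma has_derivative_normalize:
  fixes x :: "'a::euclidean_space"
  assumes x: "x \<noteq> 0"
  shows "((\<lambda>x. x /\<^sub>R norm x) has_derivative
      (\<lambda>v. v /\<^sub>R norm x - ((x \<bullet> v) / norm x ^ 3) *\<^sub>R x)) (at x)"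
proof -
  have "((\<lambda>x. inverse (norm x)) has_derivative
      (\<lambda>v. - (inverse (norm x) * ((x \<bullet> v) / norm x) * inverse (norm x)))) (at x)"
    using x by (intro Deriv.has_derivative_inverse has_derivative_norm_at) auto
  from has_derivative_scaleR[OF this has_derivative_ident] show ?thesis
    by (rule has_derivative_eq_rhs) (use x in \<open>auto simp: fun_eq_iff power3_eq_cube divide_simps\<close>)
qed

lemma C1_on_normalize: "C1_on (- {0}) (\<lambda>x::'a::euclidean_space. x /\<^sub>R norm x)"
proof (rule C1_onI)
  show "continuous_on (- {0}) (\<lambda>x. v /\<^sub>R norm x - ((x \<bullet> v) / norm x ^ 3) *\<^sub>R x)" for v :: 'a
    by (intro continuous_intros) auto
qed (use has_derivative_normalize in auto)

section \<open>The homogeneous extension of an integrand\<close>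

definition hom_ext :: "('a::euclidean_space \<Rightarrow> real) \<Rightarrow> 'a \<Rightarrow> real" where
  "hom_ext \<gamma> x = norm x * \<gamma> (x /\<^sub>R norm x)"

text \<open>
  Near \<open>p\<close>, \<open>F x = \<bar>x\<bar> G(u)\<close> with \<open>u = x / \<bar>x\<bar>\<close>, where \<open>G\<close> is a \<open>C\<^sup>2\<close> extension of \<open>\<gamma>\<close> to an open
  subset of the ambient space.  The product and chain rules give the gradient in closed form,
  \<open>Y u = G(u) u + (\<nabla>G(u) - (\<nabla>G(u) \<bullet> u) u)\<close>, and this expression contains only first
  derivatives of \<open>G\<close>.
\<close>

lemma hom_ext_gradient_locally:
  fixes \<gamma> :: "'a::euclidean_space \<Rightarrow> real"
  assumes "C2_on_sphere \<gamma>" and p: "p \<noteq> 0"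
  shows "\<exists>V X. open V \<and> p \<in> V \<and> V \<subseteq> - {0} \<and> C1_on V X \<and>
    (\<forall>x\<in>V. (hom_ext \<gamma> has_derivative (\<lambda>v. X x \<bullet> v)) (at x))"
proof -
  define n where "n = (\<lambda>x::'a. x /\<^sub>R norm x)"
  have "n p \<in> sphere 0 1"
    using p by (simp add: n_def)
  then obtain U and G :: "'a \<Rightarrow> real" where U: "open U" "n p \<in> U" and "C2_on U G"
    and eq: "\<And>u. u \<in> U \<Longrightarrow> norm u = 1 \<Longrightarrow> G u = \<gamma> u"
    using assms(1) unfolding C2_on_sphere_def by (metis IntI mem_sphere_0)
  then obtain G' :: "'a \<Rightarrow> 'a \<Rightarrow>\<^sub>L real"
    where G': "\<And>u. u \<in> U \<Longrightarrow> (G has_derivative G' u) (at u)" and C1G': "C1_on U G'"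
    unfolding C2_on_def by blast
  have C1G: "C1_on U G"
    using G' C1_on_imp_continuous_on[OF C1G'] unfolding C1_on_def by blast
  define g where "g = (\<lambda>u. \<Sum>b\<in>Basis. G' u b *\<^sub>R b)"
  have g: "g u \<bullet> v = G' u v" for u v
  proof -
    have "G' u v = G' u (\<Sum>b\<in>Basis. (v \<bullet> b) *\<^sub>R b)"
      by (simp add: euclidean_representation)
    also have "\<dots> = g u \<bullet> v"
      by (simp add: blinfun.bilinear_simps g_def inner_sum_left inner_commute[of v] mult.commute)
    finally show ?thesis by simp
  qed
  have C1g: "C1_on U g"
    unfolding g_def
  proof (rule C1_on_bounded_linear[OF _ C1G'])
    show "bounded_linear (\<lambda>L::'a \<Rightarrow>\<^sub>L real. \<Sum>b\<in>Basis. L b *\<^sub>R b)"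
      by (intro bounded_linear_sum bounded_linear_compose[OF bounded_linear_scaleR_left]
          blinfun.bounded_linear_left)
  qed
  define Y where "Y = (\<lambda>u. G u *\<^sub>R u + (g u + (- (g u \<bullet> u)) *\<^sub>R u))"
  have C1Y: "C1_on U Y"
    unfolding Y_def
    by (intro C1_on_add C1_on_bilinear[OF bounded_bilinear_scaleR] C1_on_bilinear[OF bounded_bilinear_inner]
        C1_on_bounded_linear[OF bounded_linear_minus[OF bounded_linear_ident]] C1G C1g C1_on_id)
  define V where "V = - {0} \<inter> n -` U"
  have contn: "continuous_on (- {0}) n"
    using C1_on_imp_continuous_on[OF C1_on_normalize] by (simp add: n_def)
  have V: "open V" "p \<in> V" "V \<subseteq> - {0}" "n ` V \<subseteq> U"
    using continuous_open_preimage[OF contn _ \<open>open U\<close>] U p by (auto simp: V_def)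
  have "C1_on V (\<lambda>x. Y (n x))"
    using C1_on_compose[OF C1_on_subset[OF C1_on_normalize V(3), folded n_def] C1Y V(4)] .
  moreover have "(hom_ext \<gamma> has_derivative (\<lambda>v. Y (n x) \<bullet> v)) (at x)" if "x \<in> V" for x
  proof -
    have x: "x \<noteq> 0" and u: "n x \<in> U"
      using that by (auto simp: V_def)
    have "((\<lambda>x. norm x * G (n x)) has_derivative
        (\<lambda>v. norm x * G' (n x) (v /\<^sub>R norm x - ((x \<bullet> v) / norm x ^ 3) *\<^sub>R x)
             + (x \<bullet> v) / norm x * G (n x))) (at x)"
      using has_derivative_mult[OF has_derivative_norm_at[OF x]
          has_derivative_compose[OF has_derivative_normalize[OF x] G'[OF u[unfolded n_def]]]]
      by (simp add: n_def)
    also have "(\<lambda>v. norm x * G' (n x) (v /\<^sub>R norm x - ((x \<bullet> v) / norm x ^ 3) *\<^sub>R x)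
             + (x \<bullet> v) / norm x * G (n x)) = (\<lambda>v. Y (n x) \<bullet> v)"
    proof
      fix v
      have "n x = x /\<^sub>R norm x" by (simp add: n_def)
      then show "norm x * G' (n x) (v /\<^sub>R norm x - ((x \<bullet> v) / norm x ^ 3) *\<^sub>R x)
             + (x \<bullet> v) / norm x * G (n x) = Y (n x) \<bullet> v"
        using x by (simp add: Y_def g[symmetric] inner_simps power3_eq_cube field_simps)
    qed
    finally show ?thesis
    proof (rule has_derivative_transform_within_open[OF _ V(1) that])
      fix y assume "y \<in> V"
      then show "norm y * G (n y) = hom_ext \<gamma> y"
        using eq[of "n y"] by (simp add: V_def hom_ext_def n_def)
    qed
  qed
  ultimately show ?thesis
    using V by blast
qed

text \<open>
  The local extensions of \<open>\<gamma>\<close> need not agree off the sphere, but the gradient of the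
  homogeneous extension does not depend on them, so the local gradients fit together.
\<close>

lemma hom_ext_gradient:
  fixes \<gamma> :: "'a::euclidean_space \<Rightarrow> real"
  assumes "C2_on_sphere \<gamma>"
  obtains X where "\<And>x. x \<noteq> 0 \<Longrightarrow> (hom_ext \<gamma> has_derivative (\<lambda>v. X x \<bullet> v)) (at x)"
    and "C1_on (- {0}) X"
proof -
  define X where "X = (\<lambda>x. SOME z. (hom_ext \<gamma> has_derivative (\<lambda>v. z \<bullet> v)) (at x))"
  have unique: "z = z'" if "(hom_ext \<gamma> has_derivative (\<lambda>v. z \<bullet> v)) (at x)"
    "(hom_ext \<gamma> has_derivative (\<lambda>v. z' \<bullet> v)) (at x)" for z z' x
    using has_derivative_unique[OF that] by (metis vector_eq_rdot)
  have loc: "\<exists>V. open V \<and> p \<in> V \<and> C1_on V X" if p: "p \<noteq> 0" for p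
  proof -
    obtain V Z where V: "open V" "p \<in> V" "V \<subseteq> - {0}" "C1_on V Z"
      and Z: "\<And>x. x \<in> V \<Longrightarrow> (hom_ext \<gamma> has_derivative (\<lambda>v. Z x \<bullet> v)) (at x)"
      using hom_ext_gradient_locally[OF assms p] by blast
    have "X x = Z x" if "x \<in> V" for x
      using Z[OF that] unfolding X_def by (metis (mono_tags, lifting) someI unique)
    then show ?thesis
      using V C1_on_transform by blast
  qed
  show thesis
  proof
    show "(hom_ext \<gamma> has_derivative (\<lambda>v. X x \<bullet> v)) (at x)" if "x \<noteq> 0" for x
      using hom_ext_gradient_locally[OF assms that] unfolding X_def by (metis (mono_tags, lifting) someI)
    show "C1_on (- {0}) X"
      by (rule C1_on_locally) (use loc in auto)
  qed
qed

section \<open>Differentiation along the sphere\<close>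

text \<open>
  Normalising the straight line \<open>\<nu> + t v\<close> gives a curve on the sphere with velocity \<open>v\<close>.
\<close>

lemma sphere_curve:
  fixes \<nu> :: "'a::euclidean_space"
  assumes \<nu>: "norm \<nu> = 1" and v: "v \<in> sphere_tangent \<nu>"
  obtains c :: "real \<Rightarrow> 'a" where "c 0 = \<nu>" "\<And>t. norm (c t) = 1"
    "(c has_vector_derivative v) (at 0)"
proof -
  have vn: "\<nu> \<bullet> v = 0"
    using v by (simp add: sphere_tangent_def inner_commute)
  have ne: "\<nu> + t *\<^sub>R v \<noteq> 0" for t :: real
  proof
    assume "\<nu> + t *\<^sub>R v = 0"
    then have "\<nu> \<bullet> (\<nu> + t *\<^sub>R v) = 0" by simp
    then show False using \<nu> vn by (simp add: inner_simps dot_square_norm)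
  qed
  show thesis
  proof (rule that[of "\<lambda>t. (\<nu> + t *\<^sub>R v) /\<^sub>R norm (\<nu> + t *\<^sub>R v)"])
    show "((\<lambda>t. (\<nu> + t *\<^sub>R v) /\<^sub>R norm (\<nu> + t *\<^sub>R v)) has_vector_derivative v) (at 0)"
    proof -
      have 1: "((\<lambda>t::real. \<nu> + t *\<^sub>R v) has_derivative (\<lambda>t. t *\<^sub>R v)) (at 0)"
        by (auto intro!: derivative_eq_intros)
      show ?thesis
        using has_derivative_compose[OF 1, of "\<lambda>x. x /\<^sub>R norm x", OF has_derivative_normalize[OF ne]]
        by (simp add: \<nu> vn has_vector_derivative_def)
    qed
  qed (use \<nu> ne in auto)
qed

text \<open>
  Composition with a curve on the sphere reduces uniqueness to that of derivatives on the line.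
\<close>

lemma has_derivative_sphere_unique:
  fixes f :: "'a::euclidean_space \<Rightarrow> 'b::real_normed_vector"
  assumes \<nu>: "norm \<nu> = 1" and v: "v \<in> sphere_tangent \<nu>"
    and L: "(f has_derivative L) (at \<nu> within sphere 0 1)"
    and M: "(f has_derivative M) (at \<nu> within sphere 0 1)"
  shows "L v = M v"
proof -
  obtain c where c: "c 0 = \<nu>" "\<And>t. norm (c t) = 1" "(c has_vector_derivative v) (at 0)"
    using sphere_curve[OF \<nu> v] by blast
  have der: "((\<lambda>t. f (c t)) has_derivative (\<lambda>t. N (t *\<^sub>R v))) (at 0)"
    if "(f has_derivative N) (at \<nu> within sphere 0 1)" for N
  proof -
    have 1: "(c has_derivative (\<lambda>t. t *\<^sub>R v)) (at 0)"
      using c(3) by (simp add: has_vector_derivative_def)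
    have 2: "(f has_derivative N) (at (c 0) within range c)"
      using that c by (auto intro: has_derivative_subset)
    show ?thesis
      using has_derivative_in_compose[OF 1 2] .
  qed
  have "(\<lambda>t::real. L (t *\<^sub>R v)) = (\<lambda>t. M (t *\<^sub>R v))"
    by (rule has_derivative_unique[OF der[OF L] der[OF M]])
  from fun_cong[OF this, of 1] show ?thesis by simp
qed

text \<open>
  Since \<open>f\<close> agrees on the sphere with \<open>f(x / \<bar>x\<bar>)\<close>, whose derivative at \<open>\<nu>\<close> is \<open>L\<close> after the
  orthogonal projection to the tangent space, that composition is a derivative of \<open>f\<close> along
  the sphere.  It vanishes on the normal, and any other such derivative has the same values on
  tangent vectors.
\<close>

lemma sphere_deriv_eq:
  fixes f :: "'a::euclidean_space \<Rightarrow> 'b::real_normed_vector"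
  assumes \<nu>: "norm \<nu> = 1" and L: "(f has_derivative L) (at \<nu> within sphere 0 1)"
  shows "sphere_deriv f \<nu> w = L (w - (\<nu> \<bullet> w) *\<^sub>R \<nu>)"
proof -
  define P where "P = (\<lambda>w. w - (\<nu> \<bullet> w) *\<^sub>R \<nu>)"
  have "\<nu> \<noteq> 0" using \<nu> by auto
  then have "((\<lambda>x. x /\<^sub>R norm x) has_derivative P) (at \<nu> within sphere 0 1)"
    using has_derivative_normalize[of \<nu>] \<nu> by (simp add: P_def has_derivative_at_withinI)
  moreover have "(f has_derivative L) (at (\<nu> /\<^sub>R norm \<nu>) within (\<lambda>x. x /\<^sub>R norm x) ` sphere 0 1)"
    using L \<nu> by (auto intro: has_derivative_subset)
  ultimately have "((\<lambda>x. f (x /\<^sub>R norm x)) has_derivative (\<lambda>w. L (P w))) (at \<nu> within sphere 0 1)"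
    by (rule has_derivative_in_compose)
  then have LP: "(f has_derivative (\<lambda>w. L (P w))) (at \<nu> within sphere 0 1)"
    by (rule has_derivative_transform[rotated 2]) (use \<nu> in auto)
  have linL: "linear L"
    using L by (rule has_derivative_linear)
  have "sphere_deriv f \<nu> = (\<lambda>w. L (P w))"
    unfolding sphere_deriv_def
  proof (rule the_equality)
    show "(f has_derivative (\<lambda>w. L (P w))) (at \<nu> within sphere 0 1) \<and> L (P \<nu>) = 0"
      using LP linL \<nu> by (simp add: P_def dot_square_norm linear_0)
    fix M assume M: "(f has_derivative M) (at \<nu> within sphere 0 1) \<and> M \<nu> = 0"
    then have linM: "linear M"
      by (blast intro: has_derivative_linear)
    show "M = (\<lambda>w. L (P w))"
    proof
      fix w
      have "P w \<in> sphere_tangent \<nu>"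
        using \<nu> by (simp add: P_def sphere_tangent_def inner_simps dot_square_norm inner_commute)
      then have "L (P w) = M (P w)"
        using has_derivative_sphere_unique[OF \<nu>] L M by blast
      also have "\<dots> = M w"
        using M by (simp add: P_def linear_diff[OF linM] linear_scale[OF linM])
      finally show "M w = L (P w)" by simp
    qed
  qed
  then show ?thesis by (simp add: P_def)
qed

section \<open>Second derivatives and symmetric operators\<close>

lemma has_real_derivative_along_line:
  fixes f :: "'a::real_normed_vector \<Rightarrow> real"
  assumes "(f has_derivative L) (at (x + t *\<^sub>R v))"
  shows "((\<lambda>s. f (x + s *\<^sub>R v)) has_real_derivative L v) (at t)"
proof -
  have 1: "((\<lambda>s. x + s *\<^sub>R v) has_derivative (\<lambda>s. s *\<^sub>R v)) (at t)"
    by (auto intro!: derivative_eq_intros)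
  have "linear L"
    using assms by (rule has_derivative_linear)
  then show ?thesis
    using has_derivative_compose[OF 1 assms]
    by (simp add: has_field_derivative_def linear_scale fun_eq_iff mult_commute_abs)
qed

text \<open>
  All one-sided minimality arguments below, including the comparison of a convex function with
  its linearisation, are instances of this.
\<close>

lemma right_derivative_nonneg:
  fixes h :: "real \<Rightarrow> real"
  assumes der: "(h has_real_derivative D) (at 0)" and "h 0 = 0" "\<And>t. 0 < t \<Longrightarrow> 0 \<le> h t"
  shows "0 \<le> D"
proof (rule ccontr)
  assume "\<not> 0 \<le> D"
  then obtain d where "0 < d" "\<And>t. 0 < t \<Longrightarrow> t < d \<Longrightarrow> h (0 + t) < h 0"
    using DERIV_neg_dec_right[OF der] by auto
  then have "h (d / 2) < 0"
    using assms(2) by (metis add_0 field_sum_of_halves half_gt_zero less_add_same_cancel1)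
  then show False
    using assms(3)[of "d / 2"] \<open>0 < d\<close> by simp
qed

text \<open>
  Two applications of the mean value theorem, first in direction \<open>v\<close> and then in direction \<open>w\<close>.
  The left-hand side is symmetric in \<open>v\<close> and \<open>w\<close>, which yields the symmetry of second derivatives.
\<close>

lemma second_difference_mean_value:
  fixes F :: "'a::real_inner \<Rightarrow> real"
  assumes grad: "\<And>x. x \<in> ball p e \<Longrightarrow> (F has_derivative (\<lambda>v. X x \<bullet> v)) (at x)"
    and hess: "\<And>x. x \<in> ball p e \<Longrightarrow> (X has_derivative H x) (at x)"
    and t: "0 < t" "t * (norm v + norm w) < e"
  obtains y where "dist p y \<le> t * (norm v + norm w)"
    and "F (p + t *\<^sub>R v + t *\<^sub>R w) - F (p + t *\<^sub>R v) - F (p + t *\<^sub>R w) + F p = t * t * (H y w \<bullet> v)"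
proof -
  have near: "dist p (p + s *\<^sub>R v + r *\<^sub>R w) \<le> t * (norm v + norm w)"
    if "0 \<le> s" "s \<le> t" "0 \<le> r" "r \<le> t" for s r
  proof -
    have "dist p (p + (s *\<^sub>R v + r *\<^sub>R w)) = norm (s *\<^sub>R v + r *\<^sub>R w)"
      by (metis add_diff_cancel_left' dist_norm dist_commute)
    then have "dist p (p + s *\<^sub>R v + r *\<^sub>R w) = norm (s *\<^sub>R v + r *\<^sub>R w)"
      by (simp add: add.assoc)
    also have "\<dots> \<le> s * norm v + r * norm w"
      using norm_triangle_ineq[of "s *\<^sub>R v" "r *\<^sub>R w"] that by simp
    also have "\<dots> \<le> t * (norm v + norm w)"
      using that by (simp add: distrib_left add_mono mult_right_mono)
    finally show ?thesis .
  qed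
  then have inball: "p + s *\<^sub>R v + r *\<^sub>R w \<in> ball p e"
    if "0 \<le> s" "s \<le> t" "0 \<le> r" "r \<le> t" for s r
    using that t(2) by (meson le_less_trans mem_ball)
  define \<phi> where "\<phi> = (\<lambda>s. F (p + t *\<^sub>R w + s *\<^sub>R v) - F (p + s *\<^sub>R v))"
  have "\<exists>s. 0 < s \<and> s < t \<and> \<phi> t - \<phi> 0 = (t - 0) * (X (p + t *\<^sub>R w + s *\<^sub>R v) \<bullet> v - X (p + s *\<^sub>R v) \<bullet> v)"
  proof (rule MVT2[OF t(1)])
    fix s assume "0 \<le> s" "s \<le> t"
    then have "p + t *\<^sub>R w + s *\<^sub>R v \<in> ball p e" "p + s *\<^sub>R v \<in> ball p e"
      using inball[of s t] inball[of s 0] t(1) by (simp_all add: algebra_simps)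
    then show "(\<phi> has_real_derivative X (p + t *\<^sub>R w + s *\<^sub>R v) \<bullet> v - X (p + s *\<^sub>R v) \<bullet> v) (at s)"
      unfolding \<phi>_def by (intro DERIV_diff has_real_derivative_along_line grad)
  qed
  then obtain s where s: "0 < s" "s < t"
    and \<phi>: "\<phi> t - \<phi> 0 = t * (X (p + t *\<^sub>R w + s *\<^sub>R v) \<bullet> v - X (p + s *\<^sub>R v) \<bullet> v)"
    by auto
  have "\<exists>r. 0 < r \<and> r < t \<and> X (p + s *\<^sub>R v + t *\<^sub>R w) \<bullet> v - X (p + s *\<^sub>R v + 0 *\<^sub>R w) \<bullet> v
      = (t - 0) * (H (p + s *\<^sub>R v + r *\<^sub>R w) w \<bullet> v)"
  proof (rule MVT2[OF t(1)])
    fix r assume "0 \<le> r" "r \<le> t"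
    then have "p + s *\<^sub>R v + r *\<^sub>R w \<in> ball p e"
      using inball s by simp
    then show "((\<lambda>r. X (p + s *\<^sub>R v + r *\<^sub>R w) \<bullet> v) has_real_derivative H (p + s *\<^sub>R v + r *\<^sub>R w) w \<bullet> v) (at r)"
      by (intro has_real_derivative_along_line has_derivative_inner_left hess)
  qed
  then obtain r where r: "0 < r" "r < t"
    and X: "X (p + s *\<^sub>R v + t *\<^sub>R w) \<bullet> v - X (p + s *\<^sub>R v) \<bullet> v = t * (H (p + s *\<^sub>R v + r *\<^sub>R w) w \<bullet> v)"
    by auto
  show thesis
  proof (rule that)
    show "dist p (p + s *\<^sub>R v + r *\<^sub>R w) \<le> t * (norm v + norm w)"
      using near s r by simp
    have "\<phi> t - \<phi> 0 = t * t * (H (p + s *\<^sub>R v + r *\<^sub>R w) w \<bullet> v)"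
      using \<phi> X by (simp add: algebra_simps)
    then show "F (p + t *\<^sub>R v + t *\<^sub>R w) - F (p + t *\<^sub>R v) - F (p + t *\<^sub>R w) + F p
        = t * t * (H (p + s *\<^sub>R v + r *\<^sub>R w) w \<bullet> v)"
      by (simp add: \<phi>_def algebra_simps)
  qed
qed

text \<open>
  Evaluate the second difference in both orders and let the two intermediate points tend to \<open>p\<close>:
  if the two values differed at \<open>p\<close>, they would differ at nearby points as well.
\<close>

lemma second_derivative_symmetric:
  fixes F :: "'a::real_inner \<Rightarrow> real"
  assumes U: "open U" "p \<in> U"
    and grad: "\<And>x. x \<in> U \<Longrightarrow> (F has_derivative (\<lambda>v. X x \<bullet> v)) (at x)"
    and hess: "\<And>x. x \<in> U \<Longrightarrow> (X has_derivative H x) (at x)"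
    and cont: "\<And>v. continuous_on U (\<lambda>x. H x v)"
  shows "H p v \<bullet> w = H p w \<bullet> v"
proof (rule ccontr)
  assume ne: "H p v \<bullet> w \<noteq> H p w \<bullet> v"
  define d where "d = \<bar>H p v \<bullet> w - H p w \<bullet> v\<bar> / 2"
  have d: "d > 0" using ne by (simp add: d_def)
  have "continuous_on U (\<lambda>x. H x v \<bullet> w)" "continuous_on U (\<lambda>x. H x w \<bullet> v)"
    by (intro continuous_intros cont)+
  then have "isCont (\<lambda>x. H x v \<bullet> w) p" "isCont (\<lambda>x. H x w \<bullet> v) p"
    using U continuous_on_eq_continuous_at by blast+
  then obtain e1 e2 where e1: "e1 > 0" "\<And>y. dist y p < e1 \<Longrightarrow> dist (H y v \<bullet> w) (H p v \<bullet> w) < d"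
    and e2: "e2 > 0" "\<And>y. dist y p < e2 \<Longrightarrow> dist (H y w \<bullet> v) (H p w \<bullet> v) < d"
    using d unfolding continuous_at_eps_delta by metis
  obtain e3 where e3: "e3 > 0" "ball p e3 \<subseteq> U"
    using U open_contains_ball by blast
  define e where "e = min e1 (min e2 e3)"
  have e: "e > 0" "e \<le> e1" "e \<le> e2" "ball p e \<subseteq> U"
    using e1(1) e2(1) e3 by (auto simp: e_def)
  define t where "t = e / (norm v + norm w + 1)"
  have n: "norm v + norm w + 1 > 0"
    by (smt (verit) norm_ge_zero)
  have t: "t > 0" "t * (norm v + norm w) < e" "t * (norm w + norm v) < e"
    using e(1) n by (auto simp: t_def field_simps)
  obtain y where y: "dist p y \<le> t * (norm v + norm w)"
    and Dy: "F (p + t *\<^sub>R v + t *\<^sub>R w) - F (p + t *\<^sub>R v) - F (p + t *\<^sub>R w) + F p = t * t * (H y w \<bullet> v)"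
    by (rule second_difference_mean_value[of p e F X H t v w]) (use grad hess e t in blast)+
  obtain z where z: "dist p z \<le> t * (norm w + norm v)"
    and Dz: "F (p + t *\<^sub>R w + t *\<^sub>R v) - F (p + t *\<^sub>R w) - F (p + t *\<^sub>R v) + F p = t * t * (H z v \<bullet> w)"
    by (rule second_difference_mean_value[of p e F X H t w v]) (use grad hess e t in blast)+
  have eq: "p + t *\<^sub>R w + t *\<^sub>R v = p + t *\<^sub>R v + t *\<^sub>R w"
    by (simp add: algebra_simps)
  have "t * t * (H y w \<bullet> v) = t * t * (H z v \<bullet> w)"
    using Dy Dz unfolding eq by linarith
  then have "H y w \<bullet> v = H z v \<bullet> w"
    using t(1) by simp
  moreover have "dist (H y w \<bullet> v) (H p w \<bullet> v) < d" "dist (H z v \<bullet> w) (H p v \<bullet> w) < d"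
    using e1(2)[of z] e2(2)[of y] y z t e by (auto simp: dist_commute)
  ultimately show False
    unfolding d_def dist_real_def by (simp add: abs_if split: if_splits)
qed

text \<open>
  The Rayleigh quotient attains its minimum \<open>c\<close> on the compact unit sphere of \<open>T\<close>, at \<open>v\<close> say.
  The form \<open>A w \<bullet> w - c (w \<bullet> w)\<close> is then nonnegative and vanishes at \<open>v\<close>.  Its first variation
  at \<open>v\<close> in the direction \<open>z = A v - c v\<close> is \<open>2 (z \<bullet> z)\<close>, by symmetry of \<open>A\<close>, so \<open>z\<close> must be zero.
\<close>

lemma symmetric_least_eigenvalue:
  fixes A :: "'a::euclidean_space \<Rightarrow> 'a"
  assumes A: "linear A" and T: "subspace T" and into: "\<And>w. w \<in> T \<Longrightarrow> A w \<in> T"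
    and sym: "\<And>v w. v \<in> T \<Longrightarrow> w \<in> T \<Longrightarrow> A v \<bullet> w = A w \<bullet> v"
    and nontriv: "w\<^sub>0 \<in> T" "w\<^sub>0 \<noteq> 0"
  obtains c where "eigenvalue_on T A c" "\<And>w. w \<in> T \<Longrightarrow> c * (w \<bullet> w) \<le> A w \<bullet> w"
proof -
  have "compact (sphere 0 1 \<inter> T)"
    by (intro compact_Int_closed compact_sphere closed_subspace T)
  moreover have "w\<^sub>0 /\<^sub>R norm w\<^sub>0 \<in> sphere 0 1 \<inter> T"
    using nontriv T by (simp add: subspace_scale)
  moreover have "continuous_on (sphere 0 1 \<inter> T) (\<lambda>w. A w \<bullet> w)"
    using linear_continuous_on[of A] A by (intro continuous_intros) (simp add: linear_conv_bounded_linear)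
  ultimately obtain v where v: "norm v = 1" "v \<in> T"
    and min: "\<And>w. norm w = 1 \<Longrightarrow> w \<in> T \<Longrightarrow> A v \<bullet> v \<le> A w \<bullet> w"
    using continuous_attains_inf[of "sphere 0 1 \<inter> T" "\<lambda>w. A w \<bullet> w"] by (metis IntD1 IntD2 IntI empty_iff mem_sphere_0)
  define c where "c = A v \<bullet> v"
  have q: "c * (w \<bullet> w) \<le> A w \<bullet> w" if w: "w \<in> T" for w
  proof (cases "w = 0")
    case False
    have "c \<le> A (w /\<^sub>R norm w) \<bullet> (w /\<^sub>R norm w)"
      using False w T unfolding c_def by (intro min) (auto simp: subspace_scale)
    also have "\<dots> = (A w \<bullet> w) / (norm w)\<^sup>2"
      by (simp add: linear_scale[OF A] power2_eq_square divide_inverse)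
    finally show ?thesis
      using False by (simp add: dot_square_norm field_simps)
  qed (simp add: linear_0[OF A])
  define z where "z = A v - c *\<^sub>R v"
  have z: "z \<in> T"
    unfolding z_def using T v into by (intro subspace_diff subspace_scale) auto
  have "z = 0"
  proof (rule ccontr)
    assume "z \<noteq> 0"
    define a b where "a = z \<bullet> z" and "b = A z \<bullet> z - c * (z \<bullet> z)"
    have a: "a > 0" using \<open>z \<noteq> 0\<close> by (simp add: a_def)
    have b: "b \<ge> 0" using q[OF z] by (simp add: b_def)
    \<comment> \<open>The form at \<open>v + t z\<close> equals \<open>2 t a + t\<^sup>2 b\<close>, which is negative for small \<open>t < 0\<close>; the
      denominator \<open>b + 1\<close> avoids a separate treatment of \<open>b = 0\<close>.\<close>
    define t where "t = - a / (b + 1)"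
    have "v + t *\<^sub>R z \<in> T"
      using v z T by (intro subspace_add subspace_scale) auto
    from q[OF this] have "0 \<le> A (v + t *\<^sub>R z) \<bullet> (v + t *\<^sub>R z) - c * ((v + t *\<^sub>R z) \<bullet> (v + t *\<^sub>R z))"
      by simp
    also have "\<dots> = (A v \<bullet> v - c * (v \<bullet> v)) + 2 * t * (A v \<bullet> z - c * (v \<bullet> z)) + t * t * b"
      using sym[OF v(2) z]
      by (simp add: linear_add[OF A] linear_scale[OF A] inner_add_left inner_add_right b_def
          inner_commute[of z v] algebra_simps)
    also have "A v \<bullet> v - c * (v \<bullet> v) = 0"
      using v(1) by (simp add: c_def dot_square_norm)
    also have "A v \<bullet> z - c * (v \<bullet> z) = a"
      by (simp add: a_def z_def inner_diff_left)
    finally have "0 \<le> 2 * t * a + t * t * b" by simp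
    also have "\<dots> = - (a * a) * (b + 2) / (b + 1)\<^sup>2"
      using b by (simp add: t_def power2_eq_square divide_simps) (simp add: algebra_simps)
    also have "\<dots> < 0"
      using a b by (simp add: divide_less_0_iff mult_less_0_iff add_nonneg_pos)
    finally show False by simp
  qed
  then have "eigenvalue_on T A c"
    unfolding eigenvalue_on_def using v by (intro bexI[of _ v]) (auto simp: z_def)
  then show thesis
    using q by (rule that)
qed

section \<open>Gradient and Hessian of the homogeneous extension\<close>

text \<open>
  The positive integrand \<open>\<gamma>\<close> together with the gradient \<open>X\<close> and the Hessian \<open>H\<close> of its
  homogeneous extension.  Every positive \<open>\<gamma>\<close> of class \<open>C\<^sup>2\<close> gives rise to such data
  (\<open>C2_on_sphere_hom_gradient\<close> below).
\<close>

locale hom_gradient =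
  fixes \<gamma> :: "'a::euclidean_space \<Rightarrow> real" and X :: "'a \<Rightarrow> 'a" and H :: "'a \<Rightarrow> 'a \<Rightarrow> 'a"
  assumes pos: "norm \<nu> = 1 \<Longrightarrow> 0 < \<gamma> \<nu>"
    and grad: "x \<noteq> 0 \<Longrightarrow> (hom_ext \<gamma> has_derivative (\<lambda>v. X x \<bullet> v)) (at x)"
    and hess: "x \<noteq> 0 \<Longrightarrow> (X has_derivative H x) (at x)"
    and cont_hess: "continuous_on (- {0}) (\<lambda>x. H x v)"
begin

abbreviation F :: "'a \<Rightarrow> real" where "F \<equiv> hom_ext \<gamma>"

lemma F_unit: "norm \<nu> = 1 \<Longrightarrow> F \<nu> = \<gamma> \<nu>"
  by (simp add: hom_ext_def)

lemma F_0 [simp]: "F 0 = 0"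
  by (simp add: hom_ext_def)

lemma F_scale: "0 \<le> r \<Longrightarrow> F (r *\<^sub>R x) = r * F x"
  by (cases "r = 0") (auto simp: hom_ext_def divide_simps)

lemma F_pos: "x \<noteq> 0 \<Longrightarrow> 0 < F x"
  using pos[of "x /\<^sub>R norm x"] by (simp add: hom_ext_def)

lemma F_nonneg: "0 \<le> F x"
  using F_pos[of x] by (cases "x = 0") auto

lemma F_bounds:
  obtains m M where "0 < m" "\<And>x. m * norm x \<le> F x" "\<And>x. F x \<le> M * norm x"
proof -
  have cont: "continuous_on (sphere 0 1) \<gamma>"
  proof -
    have "continuous_on (sphere 0 1) F"
      by (intro continuous_at_imp_continuous_on ballI has_derivative_continuous[OF grad]) auto
    then show ?thesis
      by (rule continuous_on_eq) (simp add: F_unit)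
  qed
  have ne: "sphere (0::'a) 1 \<noteq> {}" by simp
  obtain a where a: "norm a = 1" "\<And>\<nu>. norm \<nu> = 1 \<Longrightarrow> \<gamma> a \<le> \<gamma> \<nu>"
    using continuous_attains_inf[OF compact_sphere ne cont] by auto
  obtain b where b: "norm b = 1" "\<And>\<nu>. norm \<nu> = 1 \<Longrightarrow> \<gamma> \<nu> \<le> \<gamma> b"
    using continuous_attains_sup[OF compact_sphere ne cont] by auto
  show thesis
  proof (rule that)
    show "0 < \<gamma> a" using pos a by blast
    show "\<gamma> a * norm x \<le> F x" for x
      using a(2)[of "x /\<^sub>R norm x"] by (cases "x = 0") (auto simp: hom_ext_def mult.commute intro: mult_left_mono)
    show "F x \<le> \<gamma> b * norm x" for x
      using b(2)[of "x /\<^sub>R norm x"] by (cases "x = 0") (auto simp: hom_ext_def mult.commute intro: mult_left_mono)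
  qed
qed

lemma continuous_F: "continuous_on UNIV F"
proof (rule continuous_at_imp_continuous_on, rule ballI)
  fix x
  show "isCont F x"
  proof (cases "x = 0")
    case True
    obtain m M where "0 < m" and b: "\<And>x. m * norm x \<le> F x" "\<And>x. F x \<le> M * norm x"
      by (rule F_bounds) blast
    have "(F \<longlongrightarrow> 0) (at 0)"
    proof (rule tendsto_sandwich[of "\<lambda>_. 0"])
      show "((\<lambda>x. M * norm x) \<longlongrightarrow> 0) (at 0)"
        by (intro tendsto_eq_intros) auto
    qed (use F_nonneg b(2) in auto)
    then show ?thesis using True by (simp add: isCont_def)
  qed (blast intro: grad has_derivative_continuous)
qed

text \<open>
  Both sides are the derivative of \<open>F((1 + s) x) = (1 + s) F x\<close> at \<open>s = 0\<close>.
\<close>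

lemma euler: "x \<noteq> 0 \<Longrightarrow> X x \<bullet> x = F x"
proof -
  assume x: "x \<noteq> 0"
  have "((\<lambda>s. F (x + s *\<^sub>R x)) has_real_derivative X x \<bullet> x) (at 0)"
    by (rule has_real_derivative_along_line) (simp add: grad x)
  moreover have "((\<lambda>s. F (x + s *\<^sub>R x)) has_real_derivative F x) (at 0)"
  proof (rule has_field_derivative_transform_within_open[of "\<lambda>s. (1 + s) * F x" _ _ "{-1<..}"])
    show "((\<lambda>s. (1 + s) * F x) has_real_derivative F x) (at 0)"
      by (auto intro!: derivative_eq_intros)
    show "(1 + s) * F x = F (x + s *\<^sub>R x)" if "s \<in> {-1<..}" for s
      using that F_scale[of "1 + s" x] by (simp add: algebra_simps)
  qed auto
  ultimately show ?thesis by (rule DERIV_unique)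
qed

text \<open>
  Differentiate \<open>F(r x) = r F x\<close> with respect to \<open>x\<close>.
\<close>

lemma X_scale: assumes "0 < r" "x \<noteq> 0" shows "X (r *\<^sub>R x) = X x"
proof -
  have "((\<lambda>y. r *\<^sub>R y) has_derivative (\<lambda>v. r *\<^sub>R v)) (at x)"
    by (auto intro!: derivative_eq_intros)
  from has_derivative_compose[OF this grad] assms
  have "((\<lambda>y. F (r *\<^sub>R y)) has_derivative (\<lambda>v. X (r *\<^sub>R x) \<bullet> (r *\<^sub>R v))) (at x)"
    by simp
  moreover have "((\<lambda>y. F (r *\<^sub>R y)) has_derivative (\<lambda>v. r * (X x \<bullet> v))) (at x)"
    using has_derivative_mult_right[OF grad[OF assms(2)], of r] assms by (simp add: F_scale)
  ultimately have "(\<lambda>v. X (r *\<^sub>R x) \<bullet> (r *\<^sub>R v)) = (\<lambda>v. r * (X x \<bullet> v))"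
    by (rule has_derivative_unique)
  then have "X (r *\<^sub>R x) \<bullet> v = X x \<bullet> v" for v
    using assms(1) by (metis inner_scaleR_right mult_left_cancel less_irrefl)
  then show ?thesis
    using vector_eq_rdot by blast
qed

text \<open>
  By Euler's relation the affine approximation of \<open>F\<close> at \<open>\<nu>\<close> is linear.
\<close>

lemma X_tangent_plane: "\<nu> \<noteq> 0 \<Longrightarrow> F \<nu> + X \<nu> \<bullet> (x - \<nu>) = X \<nu> \<bullet> x"
  by (simp add: inner_diff_right euler)

lemma linear_H: "x \<noteq> 0 \<Longrightarrow> linear (H x)"
  using hess by (blast intro: has_derivative_linear)

lemma H_scale: assumes "0 < r" "x \<noteq> 0" shows "H (r *\<^sub>R x) v = H x v /\<^sub>R r"
proof -
  have "((\<lambda>y. r *\<^sub>R y) has_derivative (\<lambda>v. r *\<^sub>R v)) (at x)"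
    by (auto intro!: derivative_eq_intros)
  from has_derivative_compose[OF this hess] assms
  have "((\<lambda>y. X (r *\<^sub>R y)) has_derivative (\<lambda>v. H (r *\<^sub>R x) (r *\<^sub>R v))) (at x)"
    by simp
  moreover have "((\<lambda>y. X (r *\<^sub>R y)) has_derivative H x) (at x)"
    using assms by (intro has_derivative_transform_within_open[OF hess, of x "- {0}"]) (auto simp: X_scale)
  ultimately have "(\<lambda>v. H (r *\<^sub>R x) (r *\<^sub>R v)) = H x"
    by (rule has_derivative_unique)
  then have "H (r *\<^sub>R x) (r *\<^sub>R (v /\<^sub>R r)) = H x (v /\<^sub>R r)"
    by (rule fun_cong)
  then show ?thesis
    using assms linear_H[OF assms(2)] by (simp add: linear_scale)
qed

text \<open>
  The gradient is constant along rays.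
\<close>

lemma H_radial: assumes x: "x \<noteq> 0" shows "H x x = 0"
proof -
  have "H x x \<bullet> w = 0" for w
  proof -
    have "((\<lambda>s. X (x + s *\<^sub>R x) \<bullet> w) has_real_derivative H x x \<bullet> w) (at 0)"
      by (rule has_real_derivative_along_line) (auto intro!: has_derivative_inner_left hess x)
    moreover have "((\<lambda>s. X (x + s *\<^sub>R x) \<bullet> w) has_real_derivative 0) (at 0)"
    proof (rule has_field_derivative_transform_within_open[of "\<lambda>s. X x \<bullet> w" _ _ "{-1<..}"])
      show "X x \<bullet> w = X (x + s *\<^sub>R x) \<bullet> w" if "s \<in> {-1<..}" for s
        using that X_scale[of "1 + s" x] x by (simp add: algebra_simps)
    qed auto
    ultimately show ?thesis by (rule DERIV_unique)
  qed
  then show ?thesis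
    by (metis inner_eq_zero_iff)
qed

lemma H_symmetric: "x \<noteq> 0 \<Longrightarrow> H x v \<bullet> w = H x w \<bullet> v"
  by (rule second_derivative_symmetric[of "- {0}" x F X H])
     (auto intro: grad hess cont_hess)

text \<open>
  By symmetry, \<open>H x v \<bullet> x = H x x \<bullet> v\<close>.
\<close>

lemma H_tangential: "x \<noteq> 0 \<Longrightarrow> H x v \<bullet> x = 0"
  using H_symmetric[of x v x] H_radial by simp

text \<open>
  Radial components contribute nothing to the quadratic form of \<open>H x\<close>, so it is determined by
  its values on the tangent space of the sphere at \<open>x / \<bar>x\<bar>\<close>.
\<close>

lemma H_quadratic_form:
  assumes x: "x \<noteq> 0" and "\<nu> = x /\<^sub>R norm x" and "w = v - (\<nu> \<bullet> v) *\<^sub>R \<nu>"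
  shows "norm \<nu> = 1" "w \<in> sphere_tangent \<nu>" "H x v \<bullet> v = (H \<nu> w \<bullet> w) / norm x"
proof -
  show \<nu>: "norm \<nu> = 1" using assms by simp
  then have \<nu>0: "\<nu> \<noteq> 0" by auto
  show w: "w \<in> sphere_tangent \<nu>"
    using \<nu> assms(3) by (simp add: sphere_tangent_def inner_simps dot_square_norm inner_commute)
  have xv: "x = norm x *\<^sub>R \<nu>" using assms by simp
  have v: "v = w + (\<nu> \<bullet> v) *\<^sub>R \<nu>" using assms(3) by simp
  have "H \<nu> v = H \<nu> w"
    by (subst v) (simp add: linear_add[OF linear_H[OF \<nu>0]] linear_scale[OF linear_H[OF \<nu>0]] H_radial \<nu>0)
  moreover have "H \<nu> w \<bullet> v = H \<nu> w \<bullet> w"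
    by (subst v) (simp add: inner_add_right H_tangential \<nu>0)
  moreover have "H x v = H \<nu> v /\<^sub>R norm x"
    by (subst xv, rule H_scale) (use x \<nu>0 in auto)
  ultimately show "H x v \<bullet> v = (H \<nu> w \<bullet> w) / norm x"
    by (simp add: divide_inverse)
qed

lemma tangential_part_of_tangent: "norm \<nu> = 1 \<Longrightarrow> v \<in> sphere_tangent \<nu> \<Longrightarrow> v - (\<nu> \<bullet> v) *\<^sub>R \<nu> = v"
  by (simp add: sphere_tangent_def inner_commute)

text \<open>
  The derivative of \<open>\<gamma>\<close> along the sphere is \<open>v \<mapsto> X \<nu> \<bullet> v\<close> on tangent vectors, so the gradient is
  the tangential part of \<open>X \<nu>\<close>, whose normal part is \<open>\<gamma> \<nu> \<nu>\<close> by Euler's relation.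
\<close>

lemma sphere_grad_eq:
  assumes \<nu>: "norm \<nu> = 1" shows "sphere_grad \<gamma> \<nu> = X \<nu> - \<gamma> \<nu> *\<^sub>R \<nu>"
proof -
  have \<nu>0: "\<nu> \<noteq> 0" using \<nu> by auto
  have "(\<gamma> has_derivative (\<lambda>v. X \<nu> \<bullet> v)) (at \<nu> within sphere 0 1)"
    by (rule has_derivative_transform[OF _ _ has_derivative_at_withinI[OF grad[OF \<nu>0]]])
       (use \<nu> F_unit in auto)
  then have der: "sphere_deriv \<gamma> \<nu> v = X \<nu> \<bullet> v" if "v \<in> sphere_tangent \<nu>" for v
    using sphere_deriv_eq[OF \<nu>, of \<gamma> "\<lambda>v. X \<nu> \<bullet> v" v] tangential_part_of_tangent[OF \<nu> that] by simp
  have tan: "X \<nu> - \<gamma> \<nu> *\<^sub>R \<nu> \<in> sphere_tangent \<nu>"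
    using euler[OF \<nu>0] F_unit[OF \<nu>] \<nu> by (simp add: sphere_tangent_def inner_diff_left dot_square_norm)
  show ?thesis
    unfolding sphere_grad_def
  proof (rule the_equality)
    show "X \<nu> - \<gamma> \<nu> *\<^sub>R \<nu> \<in> sphere_tangent \<nu> \<and>
        (\<forall>v\<in>sphere_tangent \<nu>. (X \<nu> - \<gamma> \<nu> *\<^sub>R \<nu>) \<bullet> v = sphere_deriv \<gamma> \<nu> v)"
      using tan der by (auto simp: inner_diff_left) (auto simp: sphere_tangent_def inner_commute)
    fix g assume g: "g \<in> sphere_tangent \<nu> \<and> (\<forall>v\<in>sphere_tangent \<nu>. g \<bullet> v = sphere_deriv \<gamma> \<nu> v)"
    define d where "d = g - (X \<nu> - \<gamma> \<nu> *\<^sub>R \<nu>)"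
    have d: "d \<in> sphere_tangent \<nu>"
      using g tan by (simp add: d_def sphere_tangent_def inner_diff_left)
    have "d \<bullet> d = 0"
    proof -
      have "\<nu> \<bullet> d = 0" using d by (simp add: sphere_tangent_def inner_commute)
      then have "(X \<nu> - \<gamma> \<nu> *\<^sub>R \<nu>) \<bullet> d = X \<nu> \<bullet> d" by (simp add: inner_diff_left)
      also have "\<dots> = g \<bullet> d" using g der[OF d] d by simp
      finally show ?thesis by (simp add: d_def inner_diff_left)
    qed
    then show "g = X \<nu> - \<gamma> \<nu> *\<^sub>R \<nu>" by (simp add: d_def)
  qed
qed

lemma cahn_hoffman_eq: "norm \<nu> = 1 \<Longrightarrow> cahn_hoffman \<gamma> \<nu> = X \<nu>"
  by (simp add: cahn_hoffman_def sphere_grad_eq)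

lemma sphere_deriv_cahn_hoffman:
  assumes \<nu>: "norm \<nu> = 1" and v: "v \<in> sphere_tangent \<nu>"
  shows "sphere_deriv (cahn_hoffman \<gamma>) \<nu> v = H \<nu> v"
proof -
  have "\<nu> \<noteq> 0" using \<nu> by auto
  then have "(cahn_hoffman \<gamma> has_derivative H \<nu>) (at \<nu> within sphere 0 1)"
    using \<nu> by (intro has_derivative_transform[OF _ _ has_derivative_at_withinI[OF hess]])
      (auto simp: cahn_hoffman_eq)
  from sphere_deriv_eq[OF \<nu> this, of v] show ?thesis
    using tangential_part_of_tangent[OF \<nu> v] by simp
qed

text \<open>
  The gradient field of \<open>\<gamma>\<close> is the restriction of \<open>X x - F x x\<close>.  Its derivative in a tangent
  direction \<open>v\<close> is \<open>H \<nu> v - \<gamma> \<nu> v\<close> up to a multiple of \<open>\<nu>\<close>, and \<open>H \<nu> v\<close> is already tangential.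
\<close>

lemma wulff_operator_eq:
  assumes \<nu>: "norm \<nu> = 1" and v: "v \<in> sphere_tangent \<nu>"
  shows "wulff_operator \<gamma> \<nu> v = H \<nu> v"
proof -
  have \<nu>0: "\<nu> \<noteq> 0" using \<nu> by auto
  have "((\<lambda>x. X x - F x *\<^sub>R x) has_derivative (\<lambda>v. H \<nu> v - (F \<nu> *\<^sub>R v + (X \<nu> \<bullet> v) *\<^sub>R \<nu>))) (at \<nu>)"
    by (intro has_derivative_diff has_derivative_scaleR has_derivative_ident grad hess \<nu>0)
  from has_derivative_at_withinI[OF this]
  have "(sphere_grad \<gamma> has_derivative (\<lambda>v. H \<nu> v - (F \<nu> *\<^sub>R v + (X \<nu> \<bullet> v) *\<^sub>R \<nu>))) (at \<nu> within sphere 0 1)"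
    by (rule has_derivative_transform[rotated 2]) (use \<nu> in \<open>auto simp: F_unit sphere_grad_eq\<close>)
  from sphere_deriv_eq[OF \<nu> this, of v]
  have "sphere_deriv (sphere_grad \<gamma>) \<nu> v = H \<nu> v - (\<gamma> \<nu> *\<^sub>R v + (X \<nu> \<bullet> v) *\<^sub>R \<nu>)"
    using tangential_part_of_tangent[OF \<nu> v] \<nu> by (simp add: F_unit)
  moreover have "v \<bullet> \<nu> = 0" using v by (simp add: sphere_tangent_def)
  ultimately show ?thesis
    using \<nu> H_tangential[OF \<nu>0, of v]
    by (simp add: wulff_operator_def sphere_hess_def Let_def inner_simps dot_square_norm)
qed

end

section \<open>The convex body bounded by the Wulff shape\<close>

definition wulff_body :: "('a::euclidean_space \<Rightarrow> real) \<Rightarrow> 'a set" where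
  "wulff_body \<gamma> = (\<Inter>\<nu>\<in>sphere 0 1. {Y. Y \<bullet> \<nu> \<le> \<gamma> \<nu>})"

lemma wulff_shape_frontier: "wulff_shape \<gamma> = frontier (wulff_body \<gamma>)"
  by (simp add: wulff_shape_def wulff_body_def)

context hom_gradient
begin

lemma mem_wulff_body: "Y \<in> wulff_body \<gamma> \<longleftrightarrow> (\<forall>x. Y \<bullet> x \<le> F x)"
proof -
  have "Y \<bullet> x \<le> F x" if "Y \<in> wulff_body \<gamma>" for x
  proof (cases "x = 0")
    case False
    then have "Y \<bullet> (x /\<^sub>R norm x) \<le> \<gamma> (x /\<^sub>R norm x)"
      using that unfolding wulff_body_def by (auto simp del: inner_scaleR_right)
    then show ?thesis
      using False by (simp add: hom_ext_def field_simps)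
  qed simp
  moreover have "Y \<in> wulff_body \<gamma>" if "\<forall>x. Y \<bullet> x \<le> F x"
    unfolding wulff_body_def
  proof (intro INT_I CollectI)
    fix \<nu> :: 'a assume "\<nu> \<in> sphere 0 1"
    then show "Y \<bullet> \<nu> \<le> \<gamma> \<nu>"
      using that F_unit[of \<nu>] by (metis mem_sphere_0)
  qed
  ultimately show ?thesis by blast
qed

lemma closed_wulff_body: "closed (wulff_body \<gamma>)"
  unfolding wulff_body_def by (intro closed_INT ballI) (simp add: inner_commute closed_halfspace_le)

lemma convex_wulff_body: "convex (wulff_body \<gamma>)"
  unfolding wulff_body_def by (intro convex_INT) (simp add: inner_commute convex_halfspace_le)

lemma bounded_wulff_body: "bounded (wulff_body \<gamma>)"
proof -
  obtain m M where M: "\<And>x. F x \<le> M * norm x"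
    by (rule F_bounds) blast
  show ?thesis
  proof (rule boundedI)
    fix Y assume "Y \<in> wulff_body \<gamma>"
    then have "Y \<bullet> Y \<le> M * norm Y"
      using M[of Y] mem_wulff_body by (meson order_trans)
    then have "norm Y * norm Y \<le> M * norm Y"
      by (simp add: dot_square_norm power2_eq_square)
    then show "norm Y \<le> max M 0"
      by (cases "Y = 0") auto
  qed
qed

text \<open>
  If all inequalities are strict at \<open>Y\<close>, then the least gap \<open>e\<close> over the compact sphere is
  positive, and the ball of radius \<open>e\<close> about \<open>Y\<close> is contained in the body.
\<close>

lemma interior_wulff_body:
  "Y \<in> interior (wulff_body \<gamma>) \<longleftrightarrow> (\<forall>\<nu>. norm \<nu> = 1 \<longrightarrow> Y \<bullet> \<nu> < \<gamma> \<nu>)"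
proof
  assume "Y \<in> interior (wulff_body \<gamma>)"
  then obtain e where e: "e > 0" "ball Y e \<subseteq> wulff_body \<gamma>"
    using mem_interior by blast
  show "\<forall>\<nu>. norm \<nu> = 1 \<longrightarrow> Y \<bullet> \<nu> < \<gamma> \<nu>"
  proof (intro allI impI)
    fix \<nu> :: 'a assume \<nu>: "norm \<nu> = 1"
    have "Y + (e / 2) *\<^sub>R \<nu> \<in> ball Y e"
      using e(1) \<nu> by (simp add: dist_norm)
    then have "(Y + (e / 2) *\<^sub>R \<nu>) \<bullet> \<nu> \<le> F \<nu>"
      using e(2) mem_wulff_body by blast
    then show "Y \<bullet> \<nu> < \<gamma> \<nu>"
      using e(1) \<nu> by (simp add: inner_add_left dot_square_norm F_unit)
  qed
next
  assume less: "\<forall>\<nu>. norm \<nu> = 1 \<longrightarrow> Y \<bullet> \<nu> < \<gamma> \<nu>"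
  have cont: "continuous_on (sphere 0 1) (\<lambda>\<nu>. F \<nu> - Y \<bullet> \<nu>)"
    by (intro continuous_intros continuous_on_subset[OF continuous_F]) auto
  have ne: "sphere (0::'a) 1 \<noteq> {}" by simp
  obtain \<mu> where \<mu>: "norm \<mu> = 1"
    and min: "\<And>\<nu>. norm \<nu> = 1 \<Longrightarrow> F \<mu> - Y \<bullet> \<mu> \<le> F \<nu> - Y \<bullet> \<nu>"
    using continuous_attains_inf[OF compact_sphere ne cont] by auto
  define e where "e = F \<mu> - Y \<bullet> \<mu>"
  have "e > 0" using less \<mu> F_unit by (simp add: e_def)
  moreover have "ball Y e \<subseteq> wulff_body \<gamma>"
  proof
    fix Z assume Z: "Z \<in> ball Y e"
    show "Z \<in> wulff_body \<gamma>"
      unfolding wulff_body_def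
    proof (intro INT_I CollectI)
      fix \<nu> :: 'a assume "\<nu> \<in> sphere 0 1"
      then have \<nu>: "norm \<nu> = 1" by simp
      have "(Z - Y) \<bullet> \<nu> \<le> norm (Z - Y)"
        using norm_cauchy_schwarz[of "Z - Y" \<nu>] \<nu> by simp
      also have "\<dots> < e" using Z by (simp add: dist_norm norm_minus_commute)
      finally show "Z \<bullet> \<nu> \<le> \<gamma> \<nu>"
        using min[OF \<nu>] \<nu> by (simp add: e_def inner_diff_left F_unit)
    qed
  qed
  ultimately show "Y \<in> interior (wulff_body \<gamma>)"
    using mem_interior by blast
qed

lemma mem_wulff_shape:
  "Y \<in> wulff_shape \<gamma> \<longleftrightarrow> Y \<in> wulff_body \<gamma> \<and> (\<exists>\<nu>. norm \<nu> = 1 \<and> Y \<bullet> \<nu> = \<gamma> \<nu>)"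
proof -
  have "Y \<bullet> \<nu> < \<gamma> \<nu> \<longleftrightarrow> Y \<bullet> \<nu> \<noteq> \<gamma> \<nu>" if "Y \<in> wulff_body \<gamma>" "norm \<nu> = 1" for \<nu>
    using that mem_wulff_body[of Y] F_unit[of \<nu>] by (metis less_le)
  then show ?thesis
    unfolding wulff_shape_frontier frontier_def closure_closed[OF closed_wulff_body]
    using interior_wulff_body[of Y] by blast
qed

text \<open>
  The function \<open>F x - Y \<bullet> x\<close> is nonnegative and vanishes at \<open>\<nu>\<close>.  Its derivative there in the
  direction \<open>v = Y - X \<nu>\<close> is \<open>- (v \<bullet> v)\<close>, which must not be negative.
\<close>

lemma contact_point:
  assumes Y: "Y \<in> wulff_body \<gamma>" and \<nu>: "norm \<nu> = 1" "Y \<bullet> \<nu> = \<gamma> \<nu>"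
  shows "Y = X \<nu>"
proof -
  define v where "v = Y - X \<nu>"
  have \<nu>0: "\<nu> \<noteq> 0" using \<nu> by auto
  have "0 \<le> X \<nu> \<bullet> v - Y \<bullet> v"
  proof (rule right_derivative_nonneg)
    show "((\<lambda>s. F (\<nu> + s *\<^sub>R v) - Y \<bullet> (\<nu> + s *\<^sub>R v)) has_real_derivative X \<nu> \<bullet> v - Y \<bullet> v) (at 0)"
    proof (rule has_real_derivative_along_line)
      show "((\<lambda>x. F x - Y \<bullet> x) has_derivative (\<lambda>v. X \<nu> \<bullet> v - Y \<bullet> v)) (at (\<nu> + 0 *\<^sub>R v))"
        by (intro has_derivative_diff has_derivative_inner_right has_derivative_ident) (simp add: grad \<nu>0)
    qed
  qed (use Y \<nu> in \<open>auto simp: mem_wulff_body F_unit\<close>)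
  also have "\<dots> = - (v \<bullet> v)"
    by (simp add: v_def inner_diff_left)
  finally have "v = 0"
    by (metis inner_eq_zero_iff inner_ge_zero neg_0_le_iff_le order_antisym)
  then show ?thesis by (simp add: v_def)
qed

lemma wulff_shape_subset: "wulff_shape \<gamma> \<subseteq> cahn_hoffman \<gamma> ` sphere 0 1"
proof
  fix Y assume "Y \<in> wulff_shape \<gamma>"
  then obtain \<nu> where "Y \<in> wulff_body \<gamma>" "norm \<nu> = 1" "Y \<bullet> \<nu> = \<gamma> \<nu>"
    using mem_wulff_shape by blast
  then show "Y \<in> cahn_hoffman \<gamma> ` sphere 0 1"
    using contact_point cahn_hoffman_eq by (intro image_eqI[of _ _ \<nu>]) auto
qed

section \<open>Convexity and supporting tangent planes\<close>

text \<open>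
  The graph of the homogeneous extension lies above all of its tangent planes, which pass through
  the origin.  Convexity of the integrand, semidefiniteness of the Hessian and the equality
  of the Wulff shape with the image of the Cahn-Hoffman map are all equivalent to this.
\<close>

definition tangent_planes_support :: bool where
  "tangent_planes_support \<longleftrightarrow> (\<forall>y. y \<noteq> 0 \<longrightarrow> (\<forall>x. X y \<bullet> x \<le> F x))"

lemma tangent_planes_supportI:
  assumes "\<And>\<nu> x. norm \<nu> = 1 \<Longrightarrow> X \<nu> \<bullet> x \<le> F x"
  shows tangent_planes_support
  unfolding tangent_planes_support_def
proof (intro allI impI)
  fix y x :: 'a assume y: "y \<noteq> 0"
  then have "X (y /\<^sub>R norm y) = X y"
    by (intro X_scale) auto
  then show "X y \<bullet> x \<le> F x"
    using assms[of "y /\<^sub>R norm y" x] y by simp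
qed

lemma tangent_planes_supportD: "tangent_planes_support \<Longrightarrow> y \<noteq> 0 \<Longrightarrow> X y \<bullet> x \<le> F x"
  by (simp add: tangent_planes_support_def)

lemma wulff_shape_eq_iff:
  "wulff_shape \<gamma> = cahn_hoffman \<gamma> ` sphere 0 1 \<longleftrightarrow> tangent_planes_support"
proof
  assume eq: "wulff_shape \<gamma> = cahn_hoffman \<gamma> ` sphere 0 1"
  show tangent_planes_support
  proof (rule tangent_planes_supportI)
    fix \<nu> x :: 'a assume "norm \<nu> = 1"
    then have "X \<nu> \<in> wulff_shape \<gamma>"
      using eq cahn_hoffman_eq by (metis imageI mem_sphere_0)
    then show "X \<nu> \<bullet> x \<le> F x"
      by (simp add: mem_wulff_shape mem_wulff_body)
  qed
next
  assume supp: tangent_planes_support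
  have "X \<nu> \<in> wulff_shape \<gamma>" if \<nu>: "norm \<nu> = 1" for \<nu>
  proof -
    have "\<nu> \<noteq> 0" using \<nu> by auto
    then show ?thesis
      using tangent_planes_supportD[OF supp] \<nu> euler[of \<nu>] F_unit[OF \<nu>]
      unfolding mem_wulff_shape mem_wulff_body by metis
  qed
  then show "wulff_shape \<gamma> = cahn_hoffman \<gamma> ` sphere 0 1"
    using wulff_shape_subset by (auto simp: cahn_hoffman_eq)
qed

lemma polar_graph: "(\<lambda>\<nu>. inverse (\<gamma> \<nu>) *\<^sub>R \<nu>) ` sphere 0 1 = {x. F x = 1}"
proof (intro set_eqI iffI)
  fix x assume "x \<in> (\<lambda>\<nu>. inverse (\<gamma> \<nu>) *\<^sub>R \<nu>) ` sphere 0 1"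
  then obtain \<nu> where "norm \<nu> = 1" "x = inverse (\<gamma> \<nu>) *\<^sub>R \<nu>" by auto
  then show "x \<in> {x. F x = 1}"
    using pos[of \<nu>] by (simp add: F_scale F_unit)
next
  fix x assume "x \<in> {x. F x = 1}"
  then have F: "norm x * \<gamma> (x /\<^sub>R norm x) = 1" by (simp add: hom_ext_def)
  then have "x \<noteq> 0" by auto
  moreover have "inverse (\<gamma> (x /\<^sub>R norm x)) = norm x"
    using F by (metis inverse_unique mult.commute)
  ultimately show "x \<in> (\<lambda>\<nu>. inverse (\<gamma> \<nu>) *\<^sub>R \<nu>) ` sphere 0 1"
    by (intro image_eqI[of _ _ "x /\<^sub>R norm x"]) auto
qed

text \<open>
  A point with \<open>F x > 1\<close> escapes to infinity along its ray, on which \<open>F\<close> increases.  A component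
  of the complement that meets \<open>{F < 1}\<close> stays in this bounded set by the intermediate value
  theorem for \<open>F\<close>.
\<close>

lemma inside_polar_graph: "inside {x. F x = 1} = {x. F x < 1}"
proof (intro set_eqI iffI CollectI)
  fix x assume x: "x \<in> inside {x. F x = 1}"
  show "F x < 1"
  proof (rule ccontr)
    assume "\<not> F x < 1"
    moreover have "F x \<noteq> 1" using x inside_no_overlap by blast
    ultimately have Fx: "F x > 1" by simp
    then have x0: "x \<noteq> 0" by auto
    define C where "C = (\<lambda>t. t *\<^sub>R x) ` {1..}"
    have "connected C"
      unfolding C_def by (intro connected_continuous_image continuous_intros) (simp add: is_interval_connected)
    moreover have "x \<in> C"
      unfolding C_def by (intro image_eqI[of _ _ 1]) auto
    moreover have "C \<subseteq> - {x. F x = 1}"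
    proof
      fix y assume "y \<in> C"
      then obtain t where t: "t \<ge> 1" "y = t *\<^sub>R x" by (auto simp: C_def)
      have "1 * 1 < t * F x" using t Fx by (intro mult_le_less_imp_less) auto
      then show "y \<in> - {x. F x = 1}" using t by (simp add: F_scale)
    qed
    ultimately have "C \<subseteq> connected_component_set (- {x. F x = 1}) x"
      by (intro connected_component_maximal) auto
    then have "bounded C"
      using x unfolding inside_def by (auto intro: bounded_subset)
    then obtain B where B: "\<And>y. y \<in> C \<Longrightarrow> norm y \<le> B"
      by (auto simp: bounded_iff)
    have "norm ((1 + \<bar>B\<bar> / norm x) *\<^sub>R x) = norm x + \<bar>B\<bar>"
      using x0 by (simp add: field_simps)
    moreover have "(1 + \<bar>B\<bar> / norm x) *\<^sub>R x \<in> C"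
      unfolding C_def by (intro imageI) simp
    ultimately have "norm x + \<bar>B\<bar> \<le> B" using B by metis
    moreover have "0 < norm x" using x0 by simp
    ultimately show False by linarith
  qed
next
  fix x assume "x \<in> {x. F x < 1}"
  then have x: "F x < 1" by simp
  obtain m M where m: "0 < m" "\<And>x. m * norm x \<le> F x"
    by (rule F_bounds) blast
  have "bounded {x. F x < 1}"
  proof (rule boundedI)
    fix y assume "y \<in> {x. F x < 1}"
    then show "norm y \<le> 1 / m"
      using m(1) m(2)[of y] by (simp add: field_simps)
  qed
  moreover have "connected_component_set (- {x. F x = 1}) x \<subseteq> {x. F x < 1}"
  proof (intro subsetI CollectI, rule ccontr)
    fix y assume y: "y \<in> connected_component_set (- {x. F x = 1}) x" and Fy: "\<not> F y < 1"
    have "connected (F ` connected_component_set (- {x. F x = 1}) x)"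
      by (intro connected_continuous_image continuous_on_subset[OF continuous_F]) auto
    moreover have "F x \<in> F ` connected_component_set (- {x. F x = 1}) x"
      using x by (intro imageI) simp
    moreover have "F y \<in> F ` connected_component_set (- {x. F x = 1}) x"
      using y by (rule imageI)
    ultimately have "1 \<in> F ` connected_component_set (- {x. F x = 1}) x"
      using x Fy unfolding connected_iff_interval by (meson less_imp_le not_less)
    then show False
      using connected_component_subset[of "- {x. F x = 1}" x] by auto
  qed
  ultimately show "x \<in> inside {x. F x = 1}"
    using x unfolding inside_def by (auto intro: bounded_subset)
qed

text \<open>
  A point with \<open>F x = 1\<close> is the limit of the points \<open>(1 - s) x\<close>, at which \<open>F\<close> is less than one.
\<close>

lemma closure_sublevel: "closure {x. F x < 1} = {x. F x \<le> 1}"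
proof
  have "closed {x. F x \<le> 1}"
    by (intro closed_Collect_le continuous_F continuous_intros)
  then show "closure {x. F x < 1} \<subseteq> {x. F x \<le> 1}"
    by (intro closure_minimal) auto
  show "{x. F x \<le> 1} \<subseteq> closure {x. F x < 1}"
  proof
    fix x assume "x \<in> {x. F x \<le> 1}"
    then have x: "F x \<le> 1" by simp
    show "x \<in> closure {x. F x < 1}"
      unfolding closure_approachable
    proof (intro allI impI)
      fix e :: real assume e: "e > 0"
      define s where "s = min (1/2) (e / (norm x + 1))"
      have n: "norm x + 1 > 0" by (simp add: add_nonneg_pos)
      have s: "0 < s" "s < 1" "s \<le> e / (norm x + 1)"
        using e n by (auto simp: s_def)
      have "s * norm x < s * (norm x + 1)" using s by simp
      also have "\<dots> \<le> e" using s n by (simp add: field_simps)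
      finally have "dist ((1 - s) *\<^sub>R x) x < e"
        using s by (simp add: dist_norm scaleR_diff_left)
      moreover have "F ((1 - s) *\<^sub>R x) < 1"
      proof -
        have "(1 - s) * F x \<le> (1 - s) * 1" using s x by (intro mult_left_mono) auto
        also have "\<dots> < 1" using s by simp
        finally show ?thesis using s by (simp add: F_scale)
      qed
      ultimately show "\<exists>y\<in>{x. F x < 1}. dist y x < e" by blast
    qed
  qed
qed

lemma convex_integrand_iff_sublevel:
  "convex_integrand \<gamma> \<longleftrightarrow> (\<forall>x y. F x = 1 \<longrightarrow> F y = 1 \<longrightarrow> closed_segment x y \<subseteq> {x. F x \<le> 1})"
  by (simp add: convex_integrand_def convex_hypersurface_def polar_graph inside_polar_graph closure_sublevel)

text \<open>
  The vector \<open>(x + y) / (F x + F y)\<close> is a convex combination, with weights proportional to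
  \<open>F x\<close> and \<open>F y\<close>, of the points \<open>x / F x\<close> and \<open>y / F y\<close> of the Wulff plot.
\<close>

lemma convex_integrand_subadditive:
  assumes "convex_integrand \<gamma>" and x: "x \<noteq> 0" and y: "y \<noteq> 0"
  shows "F (x + y) \<le> F x + F y"
proof -
  define s where "s = F x + F y"
  have p: "F x > 0" "F y > 0" "s > 0" using F_pos[OF x] F_pos[OF y] by (simp_all add: s_def)
  have "F (x /\<^sub>R F x) = 1" "F (y /\<^sub>R F y) = 1"
    using p by (simp_all add: F_scale)
  moreover have "(x + y) /\<^sub>R s \<in> closed_segment (x /\<^sub>R F x) (y /\<^sub>R F y)"
    unfolding in_segment
  proof (intro exI[of _ "F y / s"] conjI)
    have "1 - F y / s = F x / s" using p by (simp add: s_def field_simps)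
    then show "(x + y) /\<^sub>R s = (1 - F y / s) *\<^sub>R (x /\<^sub>R F x) + (F y / s) *\<^sub>R (y /\<^sub>R F y)"
      using p by (simp add: scaleR_add_right) (simp add: divide_simps)
  qed (use p in \<open>auto simp: s_def\<close>)
  ultimately have "F ((x + y) /\<^sub>R s) \<le> 1"
    using assms(1) convex_integrand_iff_sublevel by blast
  then have "F (x + y) / s \<le> 1"
    using p F_scale[of "inverse s" "x + y"] by (simp add: divide_inverse mult.commute)
  then show ?thesis
    using p by (simp add: s_def)
qed

text \<open>
  If \<open>F\<close> is subadditive, then \<open>F \<nu> + t F y - F(\<nu> + t y)\<close> is nonnegative for \<open>t > 0\<close> and vanishes at
  \<open>t = 0\<close>, so its derivative \<open>F y - X \<nu> \<bullet> y\<close> is nonnegative.  Conversely, the tangent plane at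
  \<open>z\<close> bounds \<open>F z = X z \<bullet> z\<close> by a convex combination of the values of \<open>F\<close> at the end points.
\<close>

lemma convex_integrand_iff: "convex_integrand \<gamma> \<longleftrightarrow> tangent_planes_support"
proof
  assume conv: "convex_integrand \<gamma>"
  show tangent_planes_support
  proof (rule tangent_planes_supportI)
    fix \<nu> y :: 'a assume "norm \<nu> = 1"
    then have \<nu>: "\<nu> \<noteq> 0" by auto
    show "X \<nu> \<bullet> y \<le> F y"
    proof (cases "y = 0")
      case False
      have "0 \<le> 0 + 1 * F y - X \<nu> \<bullet> y"
      proof (rule right_derivative_nonneg)
        show "((\<lambda>t. F \<nu> + t * F y - F (\<nu> + t *\<^sub>R y)) has_real_derivative 0 + 1 * F y - X \<nu> \<bullet> y) (at 0)"
        proof (intro DERIV_diff DERIV_add DERIV_const DERIV_cmult_right DERIV_ident)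
          show "((\<lambda>t. F (\<nu> + t *\<^sub>R y)) has_real_derivative X \<nu> \<bullet> y) (at 0)"
            by (rule has_real_derivative_along_line) (simp add: grad \<nu>)
        qed
        show "0 \<le> F \<nu> + t * F y - F (\<nu> + t *\<^sub>R y)" if "0 < t" for t
          using convex_integrand_subadditive[OF conv \<nu>, of "t *\<^sub>R y"] that False by (simp add: F_scale)
      qed simp
      then show ?thesis by simp
    qed simp
  qed
next
  assume supp: tangent_planes_support
  have "F z \<le> 1" if xy: "F x = 1" "F y = 1" and z: "z \<in> closed_segment x y" for x y z
  proof (cases "z = 0")
    case False
    obtain t where t: "0 \<le> t" "t \<le> 1" "z = (1 - t) *\<^sub>R x + t *\<^sub>R y"
      using z unfolding in_segment by blast
    have "F z = X z \<bullet> ((1 - t) *\<^sub>R x + t *\<^sub>R y)"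
      using euler[OF False] by (simp flip: t(3))
    also have "\<dots> = (1 - t) * (X z \<bullet> x) + t * (X z \<bullet> y)"
      by (simp only: inner_add_right inner_scaleR_right)
    also have "\<dots> \<le> (1 - t) * F x + t * F y"
      using t tangent_planes_supportD[OF supp False] by (intro add_mono mult_left_mono) auto
    finally show ?thesis using xy by simp
  qed simp
  then show "convex_integrand \<gamma>"
    unfolding convex_integrand_iff_sublevel by blast
qed

lemma eigenvalue_wulff_operator_iff:
  assumes "norm \<nu> = 1"
  shows "eigenvalue_on (sphere_tangent \<nu>) (wulff_operator \<gamma> \<nu>) c \<longleftrightarrow> eigenvalue_on (sphere_tangent \<nu>) (H \<nu>) c"
  unfolding eigenvalue_on_def using wulff_operator_eq[OF assms] by auto

text \<open>
  This turns hypotheses on eigenvalues into bounds for the quadratic form.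
\<close>

lemma hessian_lower_bound:
  assumes \<nu>: "norm \<nu> = 1" and w: "w \<in> sphere_tangent \<nu>" "w \<noteq> 0"
  obtains c where "eigenvalue_on (sphere_tangent \<nu>) (wulff_operator \<gamma> \<nu>) c" "c * (w \<bullet> w) \<le> H \<nu> w \<bullet> w"
proof -
  have \<nu>0: "\<nu> \<noteq> 0" using \<nu> by auto
  have "subspace (sphere_tangent \<nu>)"
    by (auto simp: subspace_def sphere_tangent_def inner_simps)
  moreover have "H \<nu> u \<in> sphere_tangent \<nu>" for u
    using H_tangential[OF \<nu>0] by (simp add: sphere_tangent_def)
  ultimately obtain c where "eigenvalue_on (sphere_tangent \<nu>) (H \<nu>) c"
    and "\<And>u. u \<in> sphere_tangent \<nu> \<Longrightarrow> c * (u \<bullet> u) \<le> H \<nu> u \<bullet> u"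
    by (rule symmetric_least_eigenvalue[OF linear_H[OF \<nu>0] _ _ H_symmetric[OF \<nu>0] w]) auto
  then show thesis
    using that[of c] w(1) eigenvalue_wulff_operator_iff[OF \<nu>, of c] by simp
qed

text \<open>
  If the tangent planes support, adding the inequalities at two points shows that \<open>X\<close> is
  monotone, and differentiating gives the sign of the quadratic form of \<open>H\<close>.  Conversely, two
  applications of the mean value theorem compare \<open>F\<close> at the end of a segment with its
  linearisation at the start, as long as the segment avoids the origin, where \<open>F\<close> is not smooth.
\<close>

lemma pos_semidefinite_iff: "pos_semidefinite_integrand \<gamma> \<longleftrightarrow> tangent_planes_support"
proof
  assume supp: tangent_planes_support
  show "pos_semidefinite_integrand \<gamma>"
    unfolding pos_semidefinite_integrand_def
  proof (intro ballI allI impI)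
    fix \<nu> :: 'a and c assume "\<nu> \<in> sphere 0 1"
      and ev: "eigenvalue_on (sphere_tangent \<nu>) (wulff_operator \<gamma> \<nu>) c"
    then have \<nu>: "norm \<nu> = 1" by simp
    then have \<nu>0: "\<nu> \<noteq> 0" by auto
    obtain v where v: "v \<in> sphere_tangent \<nu>" "v \<noteq> 0" "H \<nu> v = c *\<^sub>R v"
      using ev eigenvalue_wulff_operator_iff[OF \<nu>] unfolding eigenvalue_on_def by blast
    have "0 \<le> H \<nu> v \<bullet> v - 0"
    proof (rule right_derivative_nonneg)
      show "((\<lambda>t. X (\<nu> + t *\<^sub>R v) \<bullet> v - X \<nu> \<bullet> v) has_real_derivative H \<nu> v \<bullet> v - 0) (at 0)"
      proof (intro DERIV_diff DERIV_const)
        show "((\<lambda>t. X (\<nu> + t *\<^sub>R v) \<bullet> v) has_real_derivative H \<nu> v \<bullet> v) (at 0)"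
          by (rule has_real_derivative_along_line, rule has_derivative_inner_left) (simp add: hess \<nu>0)
      qed
      fix t :: real assume t: "0 < t"
      define y where "y = \<nu> + t *\<^sub>R v"
      have "y \<bullet> \<nu> = 1"
        using \<nu> v(1) by (simp add: y_def inner_add_left dot_square_norm sphere_tangent_def)
      then have y: "y \<noteq> 0" by auto
      \<comment> \<open>The tangent planes at \<open>\<nu>\<close> and at \<open>y\<close>, with Euler's relation on the right-hand sides.\<close>
      have "X \<nu> \<bullet> y \<le> X y \<bullet> y" "X y \<bullet> \<nu> \<le> X \<nu> \<bullet> \<nu>"
        using tangent_planes_supportD[OF supp \<nu>0, of y] tangent_planes_supportD[OF supp y, of \<nu>]
          euler[OF y] euler[OF \<nu>0] by simp_all
      then have "0 \<le> t * (X y \<bullet> v - X \<nu> \<bullet> v)"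
        by (simp add: y_def inner_add_right algebra_simps)
      then show "0 \<le> X (\<nu> + t *\<^sub>R v) \<bullet> v - X \<nu> \<bullet> v"
        using t by (simp add: y_def zero_le_mult_iff)
    qed simp
    then have "0 \<le> c * (v \<bullet> v)" using v by simp
    moreover have "0 < v \<bullet> v" using v(2) by simp
    ultimately show "c \<ge> 0" by (simp only: zero_le_mult_iff) auto
  qed
next
  assume psd: "pos_semidefinite_integrand \<gamma>"
  have nonneg: "0 \<le> H y v \<bullet> v" if y: "y \<noteq> 0" for y v
  proof -
    define \<nu> where "\<nu> = y /\<^sub>R norm y"
    define w where "w = v - (\<nu> \<bullet> v) *\<^sub>R \<nu>"
    note q = H_quadratic_form[OF y \<nu>_def w_def]
    have "0 \<le> H \<nu> w \<bullet> w"
    proof (cases "w = 0")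
      case False
      obtain c where "eigenvalue_on (sphere_tangent \<nu>) (wulff_operator \<gamma> \<nu>) c" "c * (w \<bullet> w) \<le> H \<nu> w \<bullet> w"
        by (rule hessian_lower_bound[OF q(1,2) False])
      then show ?thesis
        using psd[unfolded pos_semidefinite_integrand_def, rule_format, of \<nu> c] q(1)
          mult_nonneg_nonneg[of c "w \<bullet> w"] by (metis inner_ge_zero mem_sphere_0 order_trans)
    qed simp
    then show ?thesis using q(3) by simp
  qed
  show tangent_planes_support
  proof (rule tangent_planes_supportI)
    fix \<nu> x :: 'a assume \<nu>: "norm \<nu> = 1"
    then have \<nu>0: "\<nu> \<noteq> 0" by auto
    define w where "w = x - \<nu>"
    show "X \<nu> \<bullet> x \<le> F x"
    \<comment> \<open>If the segment meets the origin, \<open>x\<close> is a nonpositive multiple of \<open>\<nu>\<close> and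
      \<open>X \<nu> \<bullet> x \<le> 0 \<le> F x\<close>.\<close>
    proof (cases "\<exists>t. 0 \<le> t \<and> t \<le> 1 \<and> \<nu> + t *\<^sub>R w = 0")
      case True
      then obtain t where t: "0 \<le> t" "t \<le> 1" "\<nu> + t *\<^sub>R w = 0" by blast
      then have "t *\<^sub>R x = (t - 1) *\<^sub>R \<nu>"
        by (simp add: w_def algebra_simps)
      then have "t * (X \<nu> \<bullet> x) = (t - 1) * F \<nu>"
        using euler[OF \<nu>0] inner_scaleR_right[of "X \<nu>" t x] by simp
      also have "\<dots> \<le> 0" using t F_nonneg by (simp add: mult_nonpos_nonneg)
      finally have "X \<nu> \<bullet> x \<le> 0"
        using t \<nu>0 by (cases "t = 0") (auto simp: mult_le_0_iff)
      then show ?thesis using F_nonneg[of x] by simp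
    next
      case False
      then have ne: "\<nu> + t *\<^sub>R w \<noteq> 0" if "0 \<le> t" "t \<le> 1" for t using that by blast
      have "\<exists>s. 0 < s \<and> s < 1 \<and> F (\<nu> + 1 *\<^sub>R w) - F (\<nu> + 0 *\<^sub>R w) = (1 - 0) * (X (\<nu> + s *\<^sub>R w) \<bullet> w)"
        by (rule MVT2, simp) (rule has_real_derivative_along_line, rule grad, simp add: ne)
      then obtain s where s: "0 < s" "s < 1" and F: "F x - F \<nu> = X (\<nu> + s *\<^sub>R w) \<bullet> w"
        by (auto simp: w_def)
      have "\<exists>r. 0 < r \<and> r < s \<and> X (\<nu> + s *\<^sub>R w) \<bullet> w - X (\<nu> + 0 *\<^sub>R w) \<bullet> w
          = (s - 0) * (H (\<nu> + r *\<^sub>R w) w \<bullet> w)"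
      proof (rule MVT2[OF s(1)])
        fix r assume "0 \<le> r" "r \<le> s"
        then have "\<nu> + r *\<^sub>R w \<noteq> 0" using s by (intro ne) auto
        then show "((\<lambda>r. X (\<nu> + r *\<^sub>R w) \<bullet> w) has_real_derivative H (\<nu> + r *\<^sub>R w) w \<bullet> w) (at r)"
          by (intro has_real_derivative_along_line has_derivative_inner_left hess)
      qed
      then obtain r where r: "0 < r" "r < s"
        and "X (\<nu> + s *\<^sub>R w) \<bullet> w - X \<nu> \<bullet> w = s * (H (\<nu> + r *\<^sub>R w) w \<bullet> w)"
        by auto
      moreover have "0 \<le> s * (H (\<nu> + r *\<^sub>R w) w \<bullet> w)"
        using s r nonneg[OF ne[of r]] by simp
      ultimately show ?thesis
        using F X_tangent_plane[OF \<nu>0, of x] by (simp add: w_def)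
    qed
  qed
qed

section \<open>Uniformly convex integrands\<close>

lemma uniformly_convex_imp_support:
  assumes "uniformly_convex_integrand \<gamma>"
  shows tangent_planes_support
proof -
  have "pos_semidefinite_integrand \<gamma>"
    using assms unfolding uniformly_convex_integrand_def pos_semidefinite_integrand_def
    by (meson less_imp_le)
  then show ?thesis
    by (simp add: pos_semidefinite_iff)
qed

lemma uniformly_convex_hessian_pos:
  assumes uc: "uniformly_convex_integrand \<gamma>" and \<nu>: "norm \<nu> = 1"
    and w: "w \<in> sphere_tangent \<nu>" "w \<noteq> 0"
  shows "0 < H \<nu> w \<bullet> w"
proof -
  obtain c where c: "eigenvalue_on (sphere_tangent \<nu>) (wulff_operator \<gamma> \<nu>) c" "c * (w \<bullet> w) \<le> H \<nu> w \<bullet> w"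
    by (rule hessian_lower_bound[OF \<nu> w])
  then have "0 < c"
    using uc \<nu> unfolding uniformly_convex_integrand_def by simp
  then have "0 < c * (w \<bullet> w)"
    using w(2) by simp
  then show ?thesis
    using c(2) by linarith
qed

text \<open>
  If \<open>X\<close> had the same value at two points of the sphere, then \<open>X \<bullet> w\<close>, with \<open>w\<close> their difference,
  would have a critical point on the segment between them, so \<open>H y w \<bullet> w = 0\<close> at some \<open>y\<close> on it.  As
  \<open>w\<close> is not radial at \<open>y\<close>, this contradicts positivity.  Opposite points are excluded first, since
  their segment meets the origin; for them, \<open>F \<mu> = X \<mu> \<bullet> \<mu> = - F \<nu>\<close> would have the wrong sign.
\<close>

lemma uniformly_convex_inj:
  assumes uc: "uniformly_convex_integrand \<gamma>" and \<nu>: "norm \<nu> = 1" and \<mu>: "norm \<mu> = 1"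
    and eq: "X \<nu> = X \<mu>"
  shows "\<nu> = \<mu>"
proof (rule ccontr)
  assume "\<nu> \<noteq> \<mu>"
  have \<nu>0: "\<nu> \<noteq> 0" and \<mu>0: "\<mu> \<noteq> 0" using \<nu> \<mu> by auto
  have not_opp: "\<mu> \<noteq> - \<nu>"
  proof
    assume "\<mu> = - \<nu>"
    then have "X \<nu> \<bullet> \<mu> = - (X \<nu> \<bullet> \<nu>)" by simp
    then have "F \<mu> = - F \<nu>" using euler[OF \<mu>0] euler[OF \<nu>0] eq by simp
    then show False using F_pos[OF \<mu>0] F_pos[OF \<nu>0] by simp
  qed
  have indep: "a = 0 \<and> b = 0" if "a *\<^sub>R \<nu> = b *\<^sub>R \<mu>" for a b
  proof (rule ccontr)
    assume ab: "\<not> (a = 0 \<and> b = 0)"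
    have "\<bar>a\<bar> = \<bar>b\<bar>" using arg_cong[OF that, of norm] \<nu> \<mu> by simp
    then have a: "a \<noteq> 0" "b = a \<or> b = - a" using ab by auto
    then have "\<mu> = \<nu> \<or> \<mu> = - \<nu>"
      using that by (metis minus_minus scaleR_left_imp_eq scaleR_minus_left scaleR_minus_right)
    then show False using not_opp \<open>\<nu> \<noteq> \<mu>\<close> by auto
  qed
  define w where "w = \<mu> - \<nu>"
  have ne: "\<nu> + t *\<^sub>R w \<noteq> 0" for t
  proof
    assume "\<nu> + t *\<^sub>R w = 0"
    then have "(1 - t) *\<^sub>R \<nu> = (- t) *\<^sub>R \<mu>" by (simp add: w_def algebra_simps)
    from indep[OF this] show False by auto
  qed
  have "\<exists>s. 0 < s \<and> s < 1 \<and> X (\<nu> + 1 *\<^sub>R w) \<bullet> w - X (\<nu> + 0 *\<^sub>R w) \<bullet> w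
      = (1 - 0) * (H (\<nu> + s *\<^sub>R w) w \<bullet> w)"
  proof (rule MVT2[OF zero_less_one])
    fix s :: real
    show "((\<lambda>s. X (\<nu> + s *\<^sub>R w) \<bullet> w) has_real_derivative H (\<nu> + s *\<^sub>R w) w \<bullet> w) (at s)"
      by (rule has_real_derivative_along_line, rule has_derivative_inner_left) (simp add: hess ne)
  qed
  then obtain s where zero: "H (\<nu> + s *\<^sub>R w) w \<bullet> w = 0"
    using eq by (auto simp: w_def)
  define y where "y = \<nu> + s *\<^sub>R w"
  define u where "u = y /\<^sub>R norm y"
  define v where "v = w - (u \<bullet> w) *\<^sub>R u"
  have y: "y \<noteq> 0" using ne by (simp add: y_def)
  note q = H_quadratic_form[OF y u_def v_def]
  have "v \<noteq> 0"
  proof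
    assume "v = 0"
    then have "w = ((u \<bullet> w) / norm y) *\<^sub>R y" by (simp add: v_def u_def divide_inverse)
    then obtain a where "w = a *\<^sub>R y" by blast
    then have "(1 - a * s + a) *\<^sub>R \<nu> = (1 - a * s) *\<^sub>R \<mu>"
      by (simp add: y_def w_def algebra_simps)
    from indep[OF this] show False by auto
  qed
  then have "0 < H y w \<bullet> w"
    using uniformly_convex_hessian_pos[OF uc q(1,2)] q(3) y by simp
  then show False
    using zero by (simp add: y_def)
qed

lemma C1_on_X: "C1_on (- {0}) X"
  by (rule C1_onI[where D = H]) (use hess cont_hess in auto)

lemma uniformly_convex_embedding:
  assumes uc: "uniformly_convex_integrand \<gamma>"
  shows "sphere_embedding (cahn_hoffman \<gamma>)"
  unfolding sphere_embedding_def
proof (intro conjI ballI)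
  show "C1_on_sphere (cahn_hoffman \<gamma>)"
    unfolding C1_on_sphere_def
  proof
    fix p :: 'a assume "p \<in> sphere 0 1"
    then show "\<exists>U Z. open U \<and> p \<in> U \<and> C1_on U Z \<and> (\<forall>x\<in>U \<inter> sphere 0 1. Z x = cahn_hoffman \<gamma> x)"
      by (intro exI[of _ "- {0}"] exI[of _ X]) (auto simp: C1_on_X cahn_hoffman_eq)
  qed
next
  fix \<nu> :: 'a assume "\<nu> \<in> sphere 0 1"
  then have \<nu>: "norm \<nu> = 1" by simp
  then have \<nu>0: "\<nu> \<noteq> 0" by auto
  show "inj_on (sphere_deriv (cahn_hoffman \<gamma>) \<nu>) (sphere_tangent \<nu>)"
  proof (rule inj_onI, rule ccontr)
    fix v w assume v: "v \<in> sphere_tangent \<nu>" and w: "w \<in> sphere_tangent \<nu>" and ne: "v \<noteq> w"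
      and eq: "sphere_deriv (cahn_hoffman \<gamma>) \<nu> v = sphere_deriv (cahn_hoffman \<gamma>) \<nu> w"
    have "v - w \<in> sphere_tangent \<nu>"
      using v w by (simp add: sphere_tangent_def inner_diff_left)
    then have "0 < H \<nu> (v - w) \<bullet> (v - w)"
      using uniformly_convex_hessian_pos[OF uc \<nu>] ne by simp
    moreover have "H \<nu> (v - w) = 0"
      using eq sphere_deriv_cahn_hoffman[OF \<nu> v] sphere_deriv_cahn_hoffman[OF \<nu> w]
      by (simp add: linear_diff[OF linear_H[OF \<nu>0]])
    ultimately show False by simp
  qed
next
  have "continuous_on (sphere 0 1) X"
    by (rule continuous_on_subset[OF C1_on_imp_continuous_on[OF C1_on_X]]) auto
  then have "continuous_on (sphere 0 1) (cahn_hoffman \<gamma>)"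
    by (rule continuous_on_eq) (simp add: cahn_hoffman_eq)
  moreover have "inj_on (cahn_hoffman \<gamma>) (sphere 0 1)"
    using uniformly_convex_inj[OF uc] by (auto simp: inj_on_def cahn_hoffman_eq)
  ultimately show "\<exists>g. homeomorphism (sphere 0 1) (cahn_hoffman \<gamma> ` sphere 0 1) (cahn_hoffman \<gamma>) g"
    by (intro homeomorphism_compact compact_sphere) auto
qed

lemma outside_wulff_shape: "outside (wulff_shape \<gamma>) = - wulff_body \<gamma>"
  by (simp add: wulff_shape_frontier outside_frontier_eq_complement_closure bounded_wulff_body
      convex_wulff_body closed_wulff_body closure_closed)

lemma inside_wulff_shape: "inside (wulff_shape \<gamma>) = interior (wulff_body \<gamma>)"
  by (simp add: wulff_shape_frontier inside_frontier_eq_interior bounded_wulff_body convex_wulff_body)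

context
  assumes uc: "uniformly_convex_integrand \<gamma>"
begin

lemma X_in_wulff_shape:
  assumes "norm \<nu> = 1" shows "X \<nu> \<in> wulff_shape \<gamma>"
  using wulff_shape_eq_iff uniformly_convex_imp_support[OF uc] cahn_hoffman_eq[OF assms] assms
  by (metis imageI mem_sphere_0)

text \<open>
  A curve in the Wulff shape through \<open>X \<nu>\<close> stays in the half space \<open>Y \<bullet> \<nu> \<le> \<gamma> \<nu>\<close>, whose boundary
  contains \<open>X \<nu>\<close>, so its velocity is orthogonal to \<open>\<nu>\<close>.  For the inner side, a step along \<open>- \<nu>\<close>
  decreases the inner product with directions \<open>\<mu>\<close> that satisfy \<open>\<mu> \<bullet> \<nu> > 0\<close>; on the compact set
  \<open>C\<close> of the other unit vectors the constraints hold strictly at \<open>X \<nu>\<close>, with a uniform gap \<open>e\<close>.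
\<close>

lemma normal_of_wulff_shape:
  assumes \<nu>: "norm \<nu> = 1" shows "outward_unit_normal (wulff_shape \<gamma>) (X \<nu>) \<nu>"
proof -
  have \<nu>0: "\<nu> \<noteq> 0" using \<nu> by auto
  have body: "X \<nu> \<in> wulff_body \<gamma>"
    using X_in_wulff_shape[OF \<nu>] by (simp add: mem_wulff_shape)
  have euler': "X \<nu> \<bullet> \<nu> = \<gamma> \<nu>"
    using euler[OF \<nu>0] \<nu> by (simp add: F_unit)
  have tangential: "v \<bullet> \<nu> = 0" if "v \<in> tangent_vectors (wulff_shape \<gamma>) (X \<nu>)" for v
  proof -
    from that obtain c e where e: "e > 0" and c: "c 0 = X \<nu>" "\<And>t. \<bar>t\<bar> < e \<Longrightarrow> c t \<in> wulff_shape \<gamma>"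
      and der: "(c has_vector_derivative v) (at (0::real))"
      unfolding tangent_vectors_def by blast
    have "((\<lambda>t. c t \<bullet> \<nu>) has_derivative (\<lambda>t. (t *\<^sub>R v) \<bullet> \<nu>)) (at 0)"
      using der unfolding has_vector_derivative_def by (rule has_derivative_inner_left)
    then have "((\<lambda>t. c t \<bullet> \<nu>) has_real_derivative v \<bullet> \<nu>) (at 0)"
      by (simp add: has_field_derivative_def mult_commute_abs)
    then show ?thesis
    proof (rule DERIV_local_max[OF _ e])
      show "\<forall>t. \<bar>0 - t\<bar> < e \<longrightarrow> c t \<bullet> \<nu> \<le> c 0 \<bullet> \<nu>"
      proof (intro allI impI)
        fix t :: real assume "\<bar>0 - t\<bar> < e"
        then have "c t \<in> wulff_body \<gamma>" using c(2) by (simp add: mem_wulff_shape)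
        then have "c t \<bullet> \<nu> \<le> F \<nu>" by (simp add: mem_wulff_body)
        then show "c t \<bullet> \<nu> \<le> c 0 \<bullet> \<nu>" using c(1) euler' \<nu> by (simp add: F_unit)
      qed
    qed
  qed
  have out: "X \<nu> + t *\<^sub>R \<nu> \<in> outside (wulff_shape \<gamma>)" if "0 < t" for t
  proof -
    have "\<not> (X \<nu> + t *\<^sub>R \<nu>) \<bullet> \<nu> \<le> F \<nu>"
      using that euler' \<nu> by (simp add: inner_add_left dot_square_norm F_unit)
    then show ?thesis
      unfolding outside_wulff_shape using mem_wulff_body by blast
  qed
  \<comment> \<open>Equality would make \<open>X \<nu>\<close> a contact point in direction \<open>\<mu>\<close> too, so \<open>X \<mu> = X \<nu>\<close>.\<close>
  have strict: "X \<nu> \<bullet> \<mu> < \<gamma> \<mu>" if \<mu>: "norm \<mu> = 1" "\<mu> \<noteq> \<nu>" for \<mu>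
  proof -
    have "X \<nu> \<bullet> \<mu> \<le> \<gamma> \<mu>" using body \<mu>(1) by (metis mem_wulff_body F_unit)
    moreover have "X \<nu> \<bullet> \<mu> \<noteq> \<gamma> \<mu>"
      using contact_point[OF body \<mu>(1)] uniformly_convex_inj[OF uc \<nu> \<mu>(1)] \<mu>(2) by auto
    ultimately show ?thesis by simp
  qed
  define C where "C = sphere 0 1 \<inter> {\<mu>. \<mu> \<bullet> \<nu> \<le> 0}"
  have "compact C"
    unfolding C_def using closed_halfspace_le[of \<nu> 0]
    by (intro compact_Int_closed compact_sphere) (simp add: inner_commute)
  have "- \<nu> \<in> C" using \<nu> by (simp add: C_def)
  have "continuous_on C (\<lambda>\<mu>. F \<mu> - X \<nu> \<bullet> \<mu>)"
    by (intro continuous_intros continuous_on_subset[OF continuous_F]) auto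
  then obtain \<mu>\<^sub>0 where \<mu>\<^sub>0: "\<mu>\<^sub>0 \<in> C"
    and min: "\<And>\<mu>. \<mu> \<in> C \<Longrightarrow> F \<mu>\<^sub>0 - X \<nu> \<bullet> \<mu>\<^sub>0 \<le> F \<mu> - X \<nu> \<bullet> \<mu>"
    using continuous_attains_inf[OF \<open>compact C\<close>] \<open>- \<nu> \<in> C\<close> by blast
  define e where "e = F \<mu>\<^sub>0 - X \<nu> \<bullet> \<mu>\<^sub>0"
  have "\<mu>\<^sub>0 \<noteq> \<nu>" "norm \<mu>\<^sub>0 = 1"
    using \<mu>\<^sub>0 \<nu> by (auto simp: C_def dot_square_norm)
  then have e: "e > 0"
    using strict[of \<mu>\<^sub>0] by (simp add: e_def F_unit)
  have ins: "X \<nu> - t *\<^sub>R \<nu> \<in> inside (wulff_shape \<gamma>)" if t: "0 < t" "t < e" for t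
    unfolding inside_wulff_shape interior_wulff_body
  proof (intro allI impI)
    fix \<mu> :: 'a assume \<mu>: "norm \<mu> = 1"
    have expand: "(X \<nu> - t *\<^sub>R \<nu>) \<bullet> \<mu> = X \<nu> \<bullet> \<mu> - t * (\<mu> \<bullet> \<nu>)"
      by (simp add: inner_diff_left inner_commute[of \<nu> \<mu>])
    show "(X \<nu> - t *\<^sub>R \<nu>) \<bullet> \<mu> < \<gamma> \<mu>"
    proof (cases "\<mu> \<bullet> \<nu> \<le> 0")
      case True
      then have "e \<le> \<gamma> \<mu> - X \<nu> \<bullet> \<mu>"
        using min[of \<mu>] \<mu> by (simp add: C_def e_def F_unit)
      moreover have "- (\<mu> \<bullet> \<nu>) \<le> 1"
        using Cauchy_Schwarz_ineq2[of \<mu> \<nu>] \<mu> \<nu> by simp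
      then have "t * (- (\<mu> \<bullet> \<nu>)) \<le> t * 1"
        using t by (intro mult_left_mono) auto
      ultimately show ?thesis using t expand by simp
    next
      case False
      then have "0 < t * (\<mu> \<bullet> \<nu>)" using t by simp
      moreover have "X \<nu> \<bullet> \<mu> \<le> \<gamma> \<mu>"
        using body \<mu> by (metis mem_wulff_body F_unit)
      ultimately show ?thesis using expand by simp
    qed
  qed
  show ?thesis
    unfolding outward_unit_normal_def using \<nu> tangential e out ins by blast
qed

text \<open>
  The image of a curve on the sphere under \<open>X\<close> shows that every \<open>H \<nu> v\<close> is tangent to the Wulff
  shape.  Taking \<open>v\<close> to be the tangential part \<open>n\<close> of \<open>N\<close> yields \<open>H \<nu> n \<bullet> n = 0\<close>, so \<open>N\<close> is \<open>\<nu>\<close> or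
  \<open>- \<nu>\<close>; the latter points inwards.
\<close>

lemma normal_of_wulff_shape_unique:
  assumes \<nu>: "norm \<nu> = 1" and N: "outward_unit_normal (wulff_shape \<gamma>) (X \<nu>) N"
  shows "N = \<nu>"
proof -
  have \<nu>0: "\<nu> \<noteq> 0" using \<nu> by auto
  have tangent: "H \<nu> v \<in> tangent_vectors (wulff_shape \<gamma>) (X \<nu>)" if v: "v \<in> sphere_tangent \<nu>" for v
  proof -
    obtain c where c: "c 0 = \<nu>" "\<And>t. norm (c t) = 1" "(c has_vector_derivative v) (at 0)"
      using sphere_curve[OF \<nu> v] by blast
    have "(c has_derivative (\<lambda>t. t *\<^sub>R v)) (at 0)"
      using c(3) by (simp add: has_vector_derivative_def)
    moreover have "(X has_derivative H \<nu>) (at (c 0))"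
      using hess[OF \<nu>0] c(1) by simp
    ultimately have "((\<lambda>t. X (c t)) has_derivative (\<lambda>t. H \<nu> (t *\<^sub>R v))) (at 0)"
      by (rule has_derivative_compose)
    then have "((\<lambda>t. X (c t)) has_vector_derivative H \<nu> v) (at 0)"
      by (simp add: has_vector_derivative_def linear_scale[OF linear_H[OF \<nu>0]])
    then show ?thesis
      unfolding tangent_vectors_def using c X_in_wulff_shape
      by (intro CollectI exI[of _ "\<lambda>t. X (c t)"] exI[of _ 1]) auto
  qed
  define n where "n = N - (\<nu> \<bullet> N) *\<^sub>R \<nu>"
  have n: "n \<in> sphere_tangent \<nu>"
    using \<nu> by (simp add: n_def sphere_tangent_def inner_simps dot_square_norm inner_commute)
  have "H \<nu> n \<bullet> N = 0"
    using N tangent[OF n] by (simp add: outward_unit_normal_def)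
  moreover have "H \<nu> n \<bullet> \<nu> = 0"
    by (rule H_tangential[OF \<nu>0])
  ultimately have "H \<nu> n \<bullet> n = 0"
    unfolding n_def by (simp add: inner_diff_right)
  then have "n = 0"
    using uniformly_convex_hessian_pos[OF uc \<nu> n] by force
  then have N\<nu>: "N = (\<nu> \<bullet> N) *\<^sub>R \<nu>"
    by (simp add: n_def)
  moreover have "norm N = 1"
    using N by (simp add: outward_unit_normal_def)
  ultimately have "\<bar>\<nu> \<bullet> N\<bar> = 1"
    using \<nu> by (metis mult.right_neutral norm_scaleR)
  then consider "\<nu> \<bullet> N = 1" | "\<nu> \<bullet> N = - 1" by linarith
  then show ?thesis
  proof cases
    case 1 then show ?thesis using N\<nu> by simp
  next
    case 2
    then have Nm: "N = - \<nu>" using N\<nu> by simp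
    obtain d where d: "d > 0" "\<And>t. 0 < t \<Longrightarrow> t < d \<Longrightarrow> X \<nu> + t *\<^sub>R N \<in> outside (wulff_shape \<gamma>)"
      using N unfolding outward_unit_normal_def by blast
    obtain e where e: "e > 0" "\<And>t. 0 < t \<Longrightarrow> t < e \<Longrightarrow> X \<nu> - t *\<^sub>R \<nu> \<in> inside (wulff_shape \<gamma>)"
      using normal_of_wulff_shape[OF \<nu>] unfolding outward_unit_normal_def by blast
    define t where "t = min d e / 2"
    have "0 < t" "t < d" "t < e" using d(1) e(1) by (auto simp: t_def min_def)
    then have "X \<nu> - t *\<^sub>R \<nu> \<in> outside (wulff_shape \<gamma>) \<inter> inside (wulff_shape \<gamma>)"
      using d(2)[of t] e(2)[of t] Nm by simp
    then show ?thesis using inside_Int_outside by blast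
  qed
qed

lemma support_function_wulff_shape:
  assumes \<nu>: "norm \<nu> = 1" shows "support_function (wulff_shape \<gamma>) \<nu> = \<gamma> \<nu>"
  unfolding support_function_def
proof (rule Least_equality)
  show "wulff_shape \<gamma> \<subseteq> {Y. Y \<bullet> \<nu> \<le> \<gamma> \<nu>}"
    using \<nu> by (auto simp: mem_wulff_shape wulff_body_def)
  fix a assume "wulff_shape \<gamma> \<subseteq> {Y. Y \<bullet> \<nu> \<le> a}"
  then have "X \<nu> \<bullet> \<nu> \<le> a" using X_in_wulff_shape[OF \<nu>] by blast
  moreover have "\<nu> \<noteq> 0" using \<nu> by auto
  ultimately show "\<gamma> \<nu> \<le> a" using euler[of \<nu>] \<nu> by (simp add: F_unit)
qed

end

end

lemma C2_on_sphere_hom_gradient: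
  fixes \<gamma> :: "'a::euclidean_space \<Rightarrow> real"
  assumes "C2_on_sphere \<gamma>" and "\<forall>\<nu>\<in>sphere 0 1. \<gamma> \<nu> > 0"
  obtains X H where "hom_gradient \<gamma> X H"
proof -
  obtain X where X: "\<And>x. x \<noteq> 0 \<Longrightarrow> (hom_ext \<gamma> has_derivative (\<lambda>v. X x \<bullet> v)) (at x)"
    and C1: "C1_on (- {0}) X"
    by (rule hom_ext_gradient[OF assms(1)]) blast
  obtain H where H: "\<And>x. x \<in> - {0} \<Longrightarrow> (X has_derivative H x) (at x)"
    and cont: "\<And>v. continuous_on (- {0}) (\<lambda>x. H x v)"
    by (rule C1_onE[OF C1]) blast
  show thesis
    by (rule that[of X H], unfold_locales) (use X H cont assms(2) in auto)
qed

theorem theorem4p1: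
  fixes \<gamma> :: "'a::euclidean_space \<Rightarrow> real"
  assumes "C2_on_sphere \<gamma>"
    and "\<forall>\<nu>\<in>sphere 0 1. \<gamma> \<nu> > 0"
  shows "wulff_shape \<gamma> \<subseteq> cahn_hoffman \<gamma> ` sphere 0 1
    \<and> ((convex_integrand \<gamma> \<longleftrightarrow> wulff_shape \<gamma> = cahn_hoffman \<gamma> ` sphere 0 1)
       \<and> (wulff_shape \<gamma> = cahn_hoffman \<gamma> ` sphere 0 1 \<longleftrightarrow> pos_semidefinite_integrand \<gamma>))
    \<and> (uniformly_convex_integrand \<gamma> \<longrightarrow>
         sphere_embedding (cahn_hoffman \<gamma>)
         \<and> cahn_hoffman \<gamma> ` sphere 0 1 = wulff_shape \<gamma>
         \<and> (\<forall>\<nu>\<in>sphere 0 1.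
              (\<forall>N. outward_unit_normal (wulff_shape \<gamma>) (cahn_hoffman \<gamma> \<nu>) N \<longleftrightarrow> N = \<nu>)
              \<and> support_function (wulff_shape \<gamma>) \<nu> = \<gamma> \<nu>
              \<and> \<gamma> \<nu> = cahn_hoffman \<gamma> \<nu> \<bullet> \<nu>))"
proof -
  obtain X H where "hom_gradient \<gamma> X H"
    using assms by (rule C2_on_sphere_hom_gradient)
  then interpret hom_gradient \<gamma> X H .
  show ?thesis
  proof (intro conjI impI ballI allI)
    show "wulff_shape \<gamma> \<subseteq> cahn_hoffman \<gamma> ` sphere 0 1"
      by (rule wulff_shape_subset)
    show "convex_integrand \<gamma> \<longleftrightarrow> wulff_shape \<gamma> = cahn_hoffman \<gamma> ` sphere 0 1"
      "wulff_shape \<gamma> = cahn_hoffman \<gamma> ` sphere 0 1 \<longleftrightarrow> pos_semidefinite_integrand \<gamma>"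
      by (simp_all only: convex_integrand_iff wulff_shape_eq_iff pos_semidefinite_iff)
  next
    assume uc: "uniformly_convex_integrand \<gamma>"
    show "sphere_embedding (cahn_hoffman \<gamma>)"
      by (rule uniformly_convex_embedding[OF uc])
    show "cahn_hoffman \<gamma> ` sphere 0 1 = wulff_shape \<gamma>"
      using uniformly_convex_imp_support[OF uc] wulff_shape_eq_iff by simp
    fix \<nu> :: 'a assume "\<nu> \<in> sphere 0 1"
    then have \<nu>: "norm \<nu> = 1" by simp
    show "outward_unit_normal (wulff_shape \<gamma>) (cahn_hoffman \<gamma> \<nu>) N \<longleftrightarrow> N = \<nu>" for N
      using normal_of_wulff_shape[OF uc \<nu>] normal_of_wulff_shape_unique[OF uc \<nu>]
      by (auto simp: cahn_hoffman_eq[OF \<nu>])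
    show "support_function (wulff_shape \<gamma>) \<nu> = \<gamma> \<nu>"
      by (rule support_function_wulff_shape[OF uc \<nu>])
    have "\<nu> \<noteq> 0" using \<nu> by auto
    then show "\<gamma> \<nu> = cahn_hoffman \<gamma> \<nu> \<bullet> \<nu>"
      using \<nu> by (simp add: cahn_hoffman_eq euler F_unit)
  qed
qed

end
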